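(* Let $d\ge 1$ be an integer and let $\Phi:\mathbb N\to[2,+\infty)$ be any function. Then the Lebesgue measure of $\Lambda_d(\Phi)$ satisfies $$\mathcal L(\Lambda_d(\Phi))=\begin{cases}0 & \text{if } \sum_{n=1}^\infty \frac{\log^{d-1}\Phi(n)}{\Phi(n)}<\infty,\\[1ex] 1 & \text{if } \sum_{n=1}^\infty \frac{\log^{d-1}\Phi(n)}{\Phi(n)}=\infty.\end{cases}$$
   Context: Every irrational $x\in[0,1)$ has a unique infinite continued fraction expansion $x=[a_1(x),a_2(x),\dots]=\cfrac{1}{a_1(x)+\cfrac{1}{a_2(x)+\cdots}}$ with partial quotients $a_n(x)\in\mathbb N$. For an integer $d\ge1$ and $\Phi:\mathbb N\to[2,\infty)$ define $$\Lambda_d(\Phi)=\{x\in[0,1)\setminus\mathbb Q:\ a_n(x)a_{2n}(x)\cdots a_{dn}(x)\ge \Phi(n)\text{ for infinitely many } n\in\mathbb N\}.$$ $\mathcal L$ denotes Lebesgue measure. *)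

theory Defs
  imports "HOL-Analysis.Analysis"
begin

definition gauss :: "real \<Rightarrow> real" where
  "gauss x = frac (1 / x)"

text \<open>n-th partial quotient (1-indexed): a_n(x) = floor(1 / T^(n-1) x).\<close>
definition cf_a :: "nat \<Rightarrow> real \<Rightarrow> nat" where
  "cf_a n x = nat \<lfloor>1 / (gauss ^^ (n - 1)) x\<rfloor>"

definition Lambda :: "nat \<Rightarrow> (nat \<Rightarrow> real) \<Rightarrow> real set" where
  "Lambda d Phi = {x \<in> {0..<1} - \<rat>.
      infinite {n::nat. 1 \<le> n \<and> real (\<Prod>i=1..d. cf_a (i * n) x) \<ge> Phi n}}"

end

theory Submission
  imports Defs
begin

text \<open>
  Given the first \<open>m\<close> partial quotients, the next one equals \<open>b\<close> with conditional Lebesgue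
  probability between \<open>1 / (4b\<^sup>2)\<close> and \<open>2 / b\<^sup>2\<close>. Hence the digits behave, up to constants, like
  independent variables of weight \<open>b\<^sup>-\<^sup>2\<close>, and the product of \<open>d\<close> digits is at least \<open>t\<close> with
  probability comparable to \<open>(ln t)\<^bsup>d-1\<^esup> / t\<close>. Borel-Cantelli gives the convergence part.

  For the divergence part a second moment argument is run inside an arbitrary cylinder. The events
  belonging to \<open>n\<close> and \<open>m\<close> are quasi-independent unless \<open>{n, 2n, \<dots>, dn}\<close> and \<open>{m, 2m, \<dots>, dm}\<close>
  meet; for given \<open>n\<close> this happens for at most \<open>d\<^sup>2\<close> values of \<open>m\<close>, so these pairs contribute
  only linearly in the sum of the probabilities. The events thus have density bounded below in
  every cylinder, uniformly, which forces full measure.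
\<close>

section \<open>Measure of cylinders\<close>

definition irr_unit :: "real set" where
  "irr_unit = {0..<1} - \<rat>"

text \<open>Removing the rationals costs no measure, and on what remains the Gauss map iterates
  forever and every digit is positive, so terminating expansions never have to be treated.\<close>

definition irr_measure :: "real measure" where
  "irr_measure = restrict_space lborel irr_unit"

definition cf_prefix :: "nat \<Rightarrow> real \<Rightarrow> nat list" where
  "cf_prefix m x = map (\<lambda>i. cf_a (Suc i) x) [0..<m]"

section \<open>The Gauss map and the digits on the irrationals: invariance, positivity,
  measurability\<close>

lemma irr_unit_bounds: "x \<in> irr_unit \<Longrightarrow> 0 < x \<and> x < 1"
  by (auto simp: irr_unit_def order_less_le)

lemma irr_unit_borel [measurable]: "irr_unit \<in> sets borel"
proof -
  have "(\<rat> :: real set) \<in> sets borel"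
    using null_setsD2[OF countable_imp_null_set_lborel[OF countable_rat]] by simp
  then show ?thesis by (simp add: irr_unit_def)
qed

lemma gauss_irr_unit:
  assumes "x \<in> irr_unit" shows "gauss x \<in> irr_unit"
proof -
  have "frac (1 / x) \<notin> \<rat>"
  proof
    assume "frac (1 / x) \<in> \<rat>"
    then have "frac (1 / x) + of_int \<lfloor>1 / x\<rfloor> \<in> \<rat>" by (intro Rats_add) auto
    then have "1 / x \<in> \<rat>" by (simp add: frac_def)
    then have "inverse (1 / x) \<in> \<rat>" by (rule Rats_inverse)
    then show False using assms by (simp add: irr_unit_def)
  qed
  then show ?thesis by (auto simp: gauss_def irr_unit_def frac_lt_1)
qed

lemma gauss_pow_irr_unit: "x \<in> irr_unit \<Longrightarrow> (gauss ^^ m) x \<in> irr_unit"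
  by (induction m) (auto intro: gauss_irr_unit)

lemma cf_a_Suc: "cf_a (Suc m) x = nat \<lfloor>1 / (gauss ^^ m) x\<rfloor>"
  by (simp add: cf_a_def)

lemma cf_a_pos: assumes "x \<in> irr_unit" shows "cf_a n x \<ge> 1"
proof -
  have "0 < (gauss ^^ (n-1)) x \<and> (gauss ^^ (n-1)) x < 1"
    using gauss_pow_irr_unit[OF assms] irr_unit_bounds by blast
  then have "1 \<le> 1 / (gauss ^^ (n-1)) x" by (simp add: field_simps)
  then have "1 \<le> \<lfloor>1 / (gauss ^^ (n-1)) x\<rfloor>" by linarith
  then show ?thesis unfolding cf_a_def by linarith
qed

lemma gauss_measurable [measurable]: "gauss \<in> borel_measurable borel"
  unfolding gauss_def[abs_def] frac_def by measurable

lemma gauss_pow_measurable [measurable]: "(gauss ^^ m) \<in> borel_measurable borel"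
  by (induction m) auto

lemma cf_a_measurable [measurable]: "cf_a n \<in> measurable borel (count_space UNIV)"
  unfolding cf_a_def[abs_def] by measurable

lemma space_irr_measure [simp]: "space irr_measure = irr_unit"
  by (simp add: irr_measure_def space_restrict_space)

lemma sets_irr_measure: "sets irr_measure = sets (restrict_space borel irr_unit)"
  by (simp add: irr_measure_def sets_restrict_space)

lemma in_sets_irr_measure: "A \<in> sets irr_measure \<longleftrightarrow> A \<in> sets borel \<and> A \<subseteq> irr_unit"
  unfolding sets_irr_measure by (subst sets_restrict_space_iff) auto

lemma cf_a_measurable' [measurable]: "cf_a n \<in> measurable irr_measure (count_space UNIV)"
  unfolding irr_measure_def by (rule measurable_restrict_space1) simp

lemma emeasure_irr_measure:
  "A \<subseteq> irr_unit \<Longrightarrow> emeasure irr_measure A = emeasure lborel A"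
  unfolding irr_measure_def by (rule emeasure_restrict_space) auto

lemma emeasure_irr_interval:
  assumes "0 \<le> \<alpha>" "\<alpha> \<le> \<beta>" "\<beta> \<le> 1"
  shows "emeasure irr_measure (irr_unit \<inter> {\<alpha><..<\<beta>}) = ennreal (\<beta> - \<alpha>)"
proof -
  have "(\<rat> :: real set) \<in> null_sets lborel"
    by (simp add: countable_imp_null_set_lborel countable_rat)
  moreover have "irr_unit \<inter> {\<alpha><..<\<beta>} = {\<alpha><..<\<beta>} - \<rat>"
    using assms by (auto simp: irr_unit_def)
  ultimately show ?thesis
    using assms emeasure_irr_measure[OF Int_lower1, of "{\<alpha><..<\<beta>}"]
    by (simp add: emeasure_Diff_null_set)
qed

section \<open>Cylinders as intervals and their exact length\<close>

lemma cf_prefix_Suc: "cf_prefix (Suc m) x = cf_prefix m x @ [cf_a (Suc m) x]"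
  by (simp add: cf_prefix_def)

text \<open>On the branch with digit \<open>b\<close> the Gauss map has inverse s -> 1 / (b + s),
  which is decreasing; hence the endpoints swap. This pulls a condition on one more Gauss iterate
  back to an interval for the previous iterate.\<close>

lemma floor_frac_interval:
  fixes y :: real
  assumes y: "y \<in> irr_unit" and b: "b \<ge> 1" and ab: "0 \<le> \<alpha>" "\<alpha> \<le> \<beta>" "\<beta> \<le> 1"
  shows "nat \<lfloor>1 / y\<rfloor> = b \<and> frac (1 / y) \<in> {\<alpha><..<\<beta>} \<longleftrightarrow>
         y \<in> {1 / (real b + \<beta>)<..<1 / (real b + \<alpha>)}" (is "?L \<longleftrightarrow> ?R")
proof -
  have y0: "0 < y" "y < 1" using irr_unit_bounds[OF y] by auto
  have R: "?R \<longleftrightarrow> real b + \<alpha> < 1 / y \<and> 1 / y < real b + \<beta>"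
    using y0 b ab by (auto simp: field_simps)
  show ?thesis
  proof
    assume L: ?L
    \<comment> \<open>Since b \<ge> 1, the value of \<open>nat\<close> cannot come from truncating a
      negative floor.\<close>
    then have "\<lfloor>1 / y\<rfloor> = int b" using b by linarith
    with L show ?R unfolding R by (auto simp: frac_def)
  next
    assume ?R
    then have r: "real b + \<alpha> < 1 / y \<and> 1 / y < real b + \<beta>" using R by simp
    then have "\<lfloor>1 / y\<rfloor> = int b" using ab by (intro floor_unique) auto
    with r show ?L by (auto simp: frac_def)
  qed
qed

text \<open>Here \<open>q\<close> and \<open>q'\<close> are the denominators of the last two convergents.\<close>
lemma cylinder_measure:
  assumes "0 \<notin> set w"
  shows "\<exists>q q'. 0 < q \<and> 0 \<le> q' \<and> q' \<le> q \<and> (\<forall>\<alpha> \<beta>. 0 \<le> \<alpha> \<longrightarrow> \<alpha> \<le> \<beta> \<longrightarrow> \<beta> \<le> 1 \<longrightarrow>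
    emeasure irr_measure {x \<in> irr_unit. cf_prefix (length w) x = w \<and> (gauss ^^ length w) x \<in> {\<alpha><..<\<beta>}}
      = ennreal ((\<beta> - \<alpha>) / ((q + q' * \<alpha>) * (q + q' * \<beta>))))"
  using assms
proof (induction w rule: rev_induct)
  case Nil
  have "{x \<in> irr_unit. cf_prefix 0 x = [] \<and> (gauss ^^ 0) x \<in> {\<alpha><..<\<beta>}} = irr_unit \<inter> {\<alpha><..<\<beta>}" for \<alpha> \<beta>
    by (auto simp: cf_prefix_def)
  \<comment> \<open>The empty expansion has denominators 1 and 0.\<close>
  then show ?case
    by (intro exI[of _ 1] exI[of _ 0]) (simp add: emeasure_irr_interval)
next
  case (snoc b w)
  then have b: "b \<ge> 1" by (cases b) auto
  let ?m = "length w"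
  from snoc.prems have "0 \<notin> set w" by simp
  from snoc.IH[OF this] obtain q q' where q: "0 < q" "0 \<le> q'" "q' \<le> q" and
    IH: "\<And>\<alpha> \<beta>. 0 \<le> \<alpha> \<Longrightarrow> \<alpha> \<le> \<beta> \<Longrightarrow> \<beta> \<le> 1 \<Longrightarrow>
     emeasure irr_measure {x \<in> irr_unit. cf_prefix ?m x = w \<and> (gauss ^^ ?m) x \<in> {\<alpha><..<\<beta>}}
      = ennreal ((\<beta> - \<alpha>) / ((q + q' * \<alpha>) * (q + q' * \<beta>)))"
    by blast
  \<comment> \<open>The recurrence for denominators: appending the digit \<open>b\<close> replaces
    the pair \<open>q\<close>, \<open>q'\<close> by \<open>q * b + q'\<close>,
    \<open>q\<close>.\<close>
  have "emeasure irr_measure {x \<in> irr_unit. cf_prefix (length (w @ [b])) x = w @ [b] \<and>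
          (gauss ^^ length (w @ [b])) x \<in> {\<alpha><..<\<beta>}}
        = ennreal ((\<beta> - \<alpha>) / (((q * b + q') + q * \<alpha>) * ((q * b + q') + q * \<beta>)))"
    if ab: "0 \<le> \<alpha>" "\<alpha> \<le> \<beta>" "\<beta> \<le> 1" for \<alpha> \<beta> :: real
  proof -
    have "{x \<in> irr_unit. cf_prefix (length (w @ [b])) x = w @ [b] \<and>
          (gauss ^^ length (w @ [b])) x \<in> {\<alpha><..<\<beta>}} =
        {x \<in> irr_unit. cf_prefix ?m x = w \<and> (gauss ^^ ?m) x \<in> {1 / (real b + \<beta>)<..<1 / (real b + \<alpha>)}}"
      using floor_frac_interval[OF gauss_pow_irr_unit b ab]
      by (intro Collect_cong) (simp add: cf_prefix_Suc cf_a_Suc gauss_def del: greaterThanLessThan_iff, blast)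
    also have "emeasure irr_measure \<dots> = ennreal ((1 / (real b + \<alpha>) - 1 / (real b + \<beta>)) /
        ((q + q' * (1 / (real b + \<beta>))) * (q + q' * (1 / (real b + \<alpha>)))))"
      using ab b by (intro IH frac_le divide_le_eq_1_pos[THEN iffD2]) auto
    also have "(1 / (real b + \<alpha>) - 1 / (real b + \<beta>)) /
        ((q + q' * (1 / (real b + \<beta>))) * (q + q' * (1 / (real b + \<alpha>)))) =
        (\<beta> - \<alpha>) / (((q * b + q') + q * \<alpha>) * ((q * b + q') + q * \<beta>))"
    proof -
      define u v where "u = real b + \<alpha>" and "v = real b + \<beta>"
      have uv: "u > 0" "v > 0" "\<beta> - \<alpha> = v - u" using ab b by (auto simp: u_def v_def)
      have e: "(q * b + q') + q * \<alpha> = q * u + q'" "(q * b + q') + q * \<beta> = q * v + q'"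
        by (auto simp: u_def v_def algebra_simps)
      have p: "q * u + q' > 0" "q * v + q' > 0"
        using q uv by (auto intro!: add_pos_nonneg)
      have e2: "q + q' * (1 / v) = (q * v + q') / v" "q + q' * (1 / u) = (q * u + q') / u"
        "1 / u - 1 / v = (v - u) / (u * v)"
        using uv by (auto simp: field_simps)
      show ?thesis
        unfolding e uv(3) u_def[symmetric] v_def[symmetric] e2
        using uv(1,2) by (simp add: mult.commute)
    qed
    finally show ?thesis .
  qed
  \<comment> \<open>Preserves the invariant that the older denominator is at most the newer one,
    which later controls the distortion.\<close>
  moreover have "q * 1 \<le> q * real b" using q b by (intro mult_left_mono) auto
  then have "0 < q * b + q'" "q \<le> q * b + q'" using q by linarith+
  moreover have "0 \<le> q" using q by simp
  ultimately show ?case by blast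
qed

section \<open>Quasi-independence of the digits\<close>

text \<open>The sigma-algebra generated by the first \<open>m\<close> digits. Prefixes are lists of
  naturals, hence countably many, so an arbitrary set \<open>W\<close> still gives a measurable
  event.\<close>

definition cf_event :: "nat \<Rightarrow> real set \<Rightarrow> bool" where
  "cf_event m A \<longleftrightarrow> (\<exists>W. A = {x \<in> irr_unit. cf_prefix m x \<in> W})"

lemma finite_measure_irr: "finite_measure irr_measure"
proof
  have "emeasure irr_measure irr_unit = emeasure lborel irr_unit"
    by (rule emeasure_irr_measure) simp
  also have "\<dots> \<le> emeasure lborel {0..1::real}"
    by (rule emeasure_mono) (auto simp: irr_unit_def)
  finally show "emeasure irr_measure (space irr_measure) \<noteq> \<infinity>"
    by (auto simp: top_unique)
qed

interpretation irr: finite_measure irr_measure by (rule finite_measure_irr)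

lemma cf_prefix_measurable [measurable]: "cf_prefix m \<in> measurable irr_measure (count_space UNIV)"
proof (induction m)
  case 0
  have "cf_prefix 0 = (\<lambda>x. [])" by (auto simp: cf_prefix_def)
  then show ?case by simp
next
  case (Suc m)
  note Suc[measurable]
  have "cf_prefix (Suc m) = (\<lambda>x. (\<lambda>(w, b). w @ [b]) (cf_prefix m x, cf_a (Suc m) x))"
    by (auto simp: cf_prefix_Suc)
  moreover have "(\<lambda>x. (cf_prefix m x, cf_a (Suc m) x)) \<in>
      measurable irr_measure (count_space UNIV \<Otimes>\<^sub>M count_space UNIV)"
    by measurable
  then have "(\<lambda>x. (cf_prefix m x, cf_a (Suc m) x)) \<in> measurable irr_measure (count_space UNIV)"
    by (simp add: pair_measure_countable)
  ultimately show ?case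
    by (simp add: measurable_compose[where N="count_space UNIV"])
qed

section \<open>Events determined by finitely many digits\<close>

lemma cf_event_sets: "cf_event m A \<Longrightarrow> A \<in> sets irr_measure"
proof -
  assume "cf_event m A"
  then obtain W where "A = {x \<in> irr_unit. cf_prefix m x \<in> W}" by (auto simp: cf_event_def)
  then have "A = {x \<in> space irr_measure. cf_prefix m x \<in> W}" by simp
  also have "\<dots> \<in> sets irr_measure" by measurable
  finally show ?thesis .
qed

lemma take_cf_prefix: "m \<le> n \<Longrightarrow> take m (cf_prefix n x) = cf_prefix m x"
  by (simp add: cf_prefix_def take_map)

lemma nth_cf_prefix: "1 \<le> j \<Longrightarrow> j \<le> n \<Longrightarrow> cf_prefix n x ! (j - 1) = cf_a j x"
  by (cases j) (simp_all add: cf_prefix_def)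

lemma cf_event_mono:
  assumes "cf_event m A" "m \<le> n" shows "cf_event n A"
proof -
  from assms obtain W where "A = {x \<in> irr_unit. cf_prefix m x \<in> W}" by (auto simp: cf_event_def)
  then have "A = {x \<in> irr_unit. cf_prefix n x \<in> {w. take m w \<in> W}}"
    using assms(2) by (simp add: take_cf_prefix)
  then show ?thesis unfolding cf_event_def by blast
qed

lemma cf_event_digit:
  assumes "cf_event m A" "m < j" shows "cf_event j {x \<in> A. cf_a j x = b}"
proof -
  have "cf_event j A" using assms by (auto intro: cf_event_mono)
  then obtain W where W: "A = {x \<in> irr_unit. cf_prefix j x \<in> W}" by (auto simp: cf_event_def)
  have "{x \<in> A. cf_a j x = b} = {x \<in> irr_unit. cf_prefix j x \<in> {w \<in> W. w ! (j - 1) = b}}"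
    using nth_cf_prefix[of j j] assms(2) unfolding W by auto
  then show ?thesis unfolding cf_event_def by blast
qed

text \<open>Within a cylinder the next digit is \<open>b\<close> exactly when the Gauss iterate lies
  between 1 / (b + 1) and 1 / b, an interval of length between 1 / (2 b^2) and 1 / b^2. Because q'
  \<le> q, the denominators in \<open>cylinder_measure\<close> distort this by at most a factor 2 in
  either direction.\<close>

lemma cylinder_ratio:
  assumes b: "b \<ge> 1"
  shows "emeasure irr_measure {x \<in> irr_unit. cf_prefix m x = w \<and> cf_a (Suc m) x = b}
           \<le> ennreal (2 / (real b)\<^sup>2) * emeasure irr_measure {x \<in> irr_unit. cf_prefix m x = w}"
    and "ennreal (1 / (4 * (real b)\<^sup>2)) * emeasure irr_measure {x \<in> irr_unit. cf_prefix m x = w}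
           \<le> emeasure irr_measure {x \<in> irr_unit. cf_prefix m x = w \<and> cf_a (Suc m) x = b}"
proof -
  let ?c = "emeasure irr_measure {x \<in> irr_unit. cf_prefix m x = w}"
  let ?e = "emeasure irr_measure {x \<in> irr_unit. cf_prefix m x = w \<and> cf_a (Suc m) x = b}"
  have "?e \<le> ennreal (2 / (real b)\<^sup>2) * ?c \<and> ennreal (1 / (4 * (real b)\<^sup>2)) * ?c \<le> ?e"
  proof (cases "length w = m \<and> 0 \<notin> set w")
    case False
    \<comment> \<open>A word of the wrong length or with a zero digit has an empty cylinder, and
      both bounds become 0 \<le> 0.\<close>
    have "0 \<notin> set (cf_prefix m x)" if "x \<in> irr_unit" for x
    proof
      assume "0 \<in> set (cf_prefix m x)"
      then obtain i where "cf_a (Suc i) x = 0" by (auto simp: cf_prefix_def)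
      then show False using cf_a_pos[OF that, of "Suc i"] by simp
    qed
    moreover have "length (cf_prefix m x) = m" for x by (simp add: cf_prefix_def)
    ultimately have *: "{x \<in> irr_unit. cf_prefix m x = w} = {}"
      using False by auto
    then have "{x \<in> irr_unit. cf_prefix m x = w \<and> cf_a (Suc m) x = b} = {}" by auto
    with * show ?thesis by (simp only: emeasure_empty mult_zero_right order_refl simp_thms zero_le)
  next
    case True
    then have m: "m = length w" and w: "0 \<notin> set w" by auto
    from cylinder_measure[OF w] obtain q q' where q: "0 < q" "0 \<le> q'" "q' \<le> q" and
      mu: "\<And>\<alpha> \<beta>. 0 \<le> \<alpha> \<Longrightarrow> \<alpha> \<le> \<beta> \<Longrightarrow> \<beta> \<le> 1 \<Longrightarrow>
       emeasure irr_measure {x \<in> irr_unit. cf_prefix m x = w \<and> (gauss ^^ m) x \<in> {\<alpha><..<\<beta>}}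
        = ennreal ((\<beta> - \<alpha>) / ((q + q' * \<alpha>) * (q + q' * \<beta>)))"
      unfolding m by blast
    \<comment> \<open>The forms \<open>+ 1\<close> and \<open>+ 0\<close> match
      \<open>floor_frac_interval\<close> at the endpoints 0 and 1.\<close>
    define \<alpha> \<beta> where "\<alpha> = 1 / (real b + 1)" and "\<beta> = 1 / (real b + 0)"
    have ab: "0 \<le> \<alpha>" "\<alpha> \<le> \<beta>" "\<beta> \<le> 1" using b by (auto simp: \<alpha>_def \<beta>_def field_simps)
    have "{x \<in> irr_unit. cf_prefix m x = w} =
        {x \<in> irr_unit. cf_prefix m x = w \<and> (gauss ^^ m) x \<in> {0<..<1}}"
      using gauss_pow_irr_unit irr_unit_bounds by fastforce
    then have c: "?c = ennreal (1 / (q * (q + q')))"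
      using mu[of 0 1] by simp
    have "nat \<lfloor>1 / y\<rfloor> = b \<longleftrightarrow> y \<in> {\<alpha><..<\<beta>}" if y: "y \<in> irr_unit" for y
    proof -
      have "frac (1 / y) \<in> {0<..<1}"
        using irr_unit_bounds[OF gauss_irr_unit[OF y]] by (simp add: gauss_def)
      then show ?thesis
        using floor_frac_interval[OF y b, of 0 1] unfolding \<alpha>_def \<beta>_def by simp
    qed
    then have "{x \<in> irr_unit. cf_prefix m x = w \<and> cf_a (Suc m) x = b} =
       {x \<in> irr_unit. cf_prefix m x = w \<and> (gauss ^^ m) x \<in> {\<alpha><..<\<beta>}}"
      using gauss_pow_irr_unit by (auto simp: cf_a_Suc simp del: greaterThanLessThan_iff)
    then have e: "?e = ennreal ((\<beta> - \<alpha>) / ((q + q' * \<alpha>) * (q + q' * \<beta>)))"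
      using mu[OF ab] by simp
    have eq: "\<beta> - \<alpha> = 1 / (real b * (real b + 1))"
      using b by (simp add: \<alpha>_def \<beta>_def field_simps)
    have ba: "\<beta> - \<alpha> \<le> 1 / (real b)\<^sup>2"
      unfolding eq power2_eq_square using b by (intro divide_left_mono mult_left_mono) auto
    have "real b * (real b + 1) \<le> real b * (2 * real b)" using b by (intro mult_left_mono) auto
    then have ba': "1 / (2 * (real b)\<^sup>2) \<le> \<beta> - \<alpha>"
      unfolding eq power2_eq_square using b by (intro divide_left_mono) auto
    have qa: "q \<le> q + q' * \<alpha>" "q + q' * \<alpha> \<le> q + q'" "q \<le> q + q' * \<beta>" "q + q' * \<beta> \<le> q + q'"
      using q ab by (auto intro: mult_left_le)
    \<comment> \<open>\<open>D\<close> is the denominator for the subinterval and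
      \<open>q * (q + q')\<close> the one for the whole cylinder; the next lines show that they
      agree up to a factor 2, using q' \<le> q.\<close>
    define D where "D = (q + q' * \<alpha>) * (q + q' * \<beta>)"
    have "q * q \<le> D" unfolding D_def using q qa by (intro mult_mono) auto
    moreover have "q * (q + q') \<le> q * (2 * q)" using q by (intro mult_left_mono) auto
    ultimately have D1: "q * (q + q') \<le> 2 * D" by simp
    have "D \<le> (q + q') * (q + q')" unfolding D_def using q qa by (intro mult_mono) auto
    also have "\<dots> \<le> (2 * q) * (q + q')" using q by (intro mult_right_mono) auto
    finally have D2: "D \<le> 2 * (q * (q + q'))" by simp
    define E where "E = q * (q + q')"
    have E0: "E > 0" using q by (auto simp: E_def)
    then have D0: "D > 0" using D1 by (simp add: E_def)
    have b0: "real b > 0" using b by simp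
    have "(\<beta> - \<alpha>) / D \<le> (1 / (real b)\<^sup>2) / (E / 2)"
      using ba D1 E0 D0 b0 ab by (intro frac_le) (auto simp: E_def)
    then have le: "(\<beta> - \<alpha>) / D \<le> 2 / (real b)\<^sup>2 * (1 / E)" by simp
    have "1 / (2 * (real b)\<^sup>2) / (2 * E) \<le> (\<beta> - \<alpha>) / D"
      using ba' D2 E0 D0 b0 ab by (intro frac_le) (auto simp: E_def)
    then have ge: "1 / (4 * (real b)\<^sup>2) * (1 / E) \<le> (\<beta> - \<alpha>) / D" by simp
    show ?thesis unfolding c e D_def[symmetric] E_def[symmetric]
      using le ge E0 D0 ab by (simp add: ennreal_mult[symmetric] ennreal_leI)
  qed
  then show "?e \<le> ennreal (2 / (real b)\<^sup>2) * ?c" "ennreal (1 / (4 * (real b)\<^sup>2)) * ?c \<le> ?e" by auto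
qed

lemma cf_event_emeasure:
  assumes P: "{x \<in> irr_unit. P x} \<in> sets irr_measure"
  shows "emeasure irr_measure {x \<in> irr_unit. cf_prefix m x \<in> W \<and> P x} =
    (\<integral>\<^sup>+w. emeasure irr_measure {x \<in> irr_unit. cf_prefix m x = w \<and> P x} \<partial>count_space W)"
proof -
  have "{x \<in> irr_unit. cf_prefix m x \<in> W \<and> P x} =
      (\<Union>w\<in>W. {x \<in> irr_unit. cf_prefix m x = w \<and> P x})" by auto
  also have "emeasure irr_measure \<dots> =
      (\<integral>\<^sup>+w. emeasure irr_measure {x \<in> irr_unit. cf_prefix m x = w \<and> P x} \<partial>count_space W)"
  proof (rule emeasure_UN_countable)
    fix w
    have "{x \<in> space irr_measure. cf_prefix m x = w} \<in> sets irr_measure" by measurable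
    from sets.Int[OF this P] show "{x \<in> irr_unit. cf_prefix m x = w \<and> P x} \<in> sets irr_measure"
      by (rule back_subst[where P="\<lambda>A. A \<in> sets irr_measure"]) auto
  qed (auto simp: disjoint_family_on_def)
  finally show ?thesis .
qed

text \<open>An event of the first \<open>m\<close> digits is also one of the first
  \<open>j - 1\<close> digits, so it splits into countably many cylinders of that depth, for each of
  which digit \<open>j\<close> is the very next one. Summing \<open>cylinder_ratio\<close> keeps the
  constants, whatever the gap between \<open>m\<close> and \<open>j\<close>.\<close>

lemma digit_ratio:
  assumes A: "cf_event m A" and mj: "m < j" and b: "b \<ge> 1"
  shows "emeasure irr_measure {x \<in> A. cf_a j x = b} \<le> ennreal (2 / (real b)\<^sup>2) * emeasure irr_measure A"
    and "ennreal (1 / (4 * (real b)\<^sup>2)) * emeasure irr_measure A \<le> emeasure irr_measure {x \<in> A. cf_a j x = b}"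
proof -
  define k where "k = j - 1"
  have j: "j = Suc k" and "m \<le> k" using mj by (auto simp: k_def)
  from cf_event_mono[OF A this(2)] obtain W where W: "A = {x \<in> irr_unit. cf_prefix k x \<in> W}"
    by (auto simp: cf_event_def)
  have eq1: "emeasure irr_measure A =
     (\<integral>\<^sup>+w. emeasure irr_measure {x \<in> irr_unit. cf_prefix k x = w} \<partial>count_space W)"
    using cf_event_emeasure[where P="\<lambda>_. True" and m=k and W=W] sets.top[of irr_measure] by (simp add: W)
  have "{x \<in> space irr_measure. cf_a (Suc k) x = b} \<in> sets irr_measure" by measurable
  then have eq2: "emeasure irr_measure {x \<in> A. cf_a j x = b} =
     (\<integral>\<^sup>+w. emeasure irr_measure {x \<in> irr_unit. cf_prefix k x = w \<and> cf_a (Suc k) x = b} \<partial>count_space W)"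
    using cf_event_emeasure[where P="\<lambda>x. cf_a (Suc k) x = b" and m=k and W=W] by (simp add: W j)
  show "emeasure irr_measure {x \<in> A. cf_a j x = b} \<le> ennreal (2 / (real b)\<^sup>2) * emeasure irr_measure A"
    unfolding eq1 eq2 by (subst nn_integral_cmult[symmetric])
      (auto intro!: nn_integral_mono cylinder_ratio b)
  show "ennreal (1 / (4 * (real b)\<^sup>2)) * emeasure irr_measure A \<le> emeasure irr_measure {x \<in> A. cf_a j x = b}"
    unfolding eq1 eq2 by (subst nn_integral_cmult[symmetric])
      (auto intro!: nn_integral_mono cylinder_ratio b)
qed

section \<open>Tails of products of digits\<close>

text \<open>The sum of \<open>(b\<^sub>1 \<cdots> b\<^sub>d)\<^sup>-\<^sup>2\<close> over all positive integers with \<open>b\<^sub>1 \<cdots> b\<^sub>d \<ge> t\<close>, one factor at a time.\<close>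
primrec prod_tail :: "nat \<Rightarrow> real \<Rightarrow> ennreal" where
  "prod_tail 0 t = (if t \<le> 1 then 1 else 0)"
| "prod_tail (Suc d) t = (\<Sum>b. ennreal (1 / (real (Suc b))\<^sup>2) * prod_tail d (t / real (Suc b)))"


text \<open>Each later term is at most the telescoping difference of reciprocals; the first is
  bounded by 1 / k, which accounts for the 2. The subtracted 1 / N makes the induction
  close.\<close>

lemma sum_inverse_squares_tail:
  assumes "1 \<le> k" "k \<le> N"
  shows "(\<Sum>b=k..N. 1 / (real b)\<^sup>2) \<le> 2 / real k - 1 / real N"
  using assms(2)
proof (induction N rule: dec_induct)
  case base
  have "1 / (real k)\<^sup>2 \<le> 1 / real k" using assms(1) by (simp add: field_simps power2_eq_square)
  then show ?case by simp
next
  case (step N)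
  have N: "real N > 0" using assms step by simp
  have "1 / (real (Suc N))\<^sup>2 \<le> 1 / real N - 1 / real (Suc N)"
  proof -
    have "1 / (real (Suc N))\<^sup>2 \<le> 1 / (real N * real (Suc N))"
      unfolding power2_eq_square using N by (intro divide_left_mono mult_right_mono) auto
    also have "\<dots> = 1 / real N - 1 / real (Suc N)" using N by (simp add: field_simps)
    finally show ?thesis .
  qed
  then show ?case using step by (simp del: of_nat_Suc)
qed

lemma sum_inverse_squares_gt:
  assumes T: "1 \<le> (T::real)"
  shows "(\<Sum>b | b < N \<and> T \<le> real (Suc b). 1 / (real (Suc b))\<^sup>2) \<le> 2 / T"
proof -
  define k where "k = nat \<lceil>T\<rceil>"
  have k: "real k \<ge> T" "k \<ge> 1" using T by (auto simp: k_def real_nat_ceiling_ge) linarith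
  have "(\<Sum>b | b < N \<and> T \<le> real (Suc b). 1 / (real (Suc b))\<^sup>2) =
     (\<Sum>b \<in> Suc ` {b. b < N \<and> T \<le> real (Suc b)}. 1 / (real b)\<^sup>2)"
    by (subst sum.reindex) auto
  \<comment> \<open>The maximum keeps the range nonempty when \<open>N\<close> is below
    \<open>k\<close>, as the telescoping bound requires.\<close>
  also have "\<dots> \<le> (\<Sum>b=k..max k N. 1 / (real b)\<^sup>2)"
  proof (intro sum_mono2)
    show "Suc ` {b. b < N \<and> T \<le> real (Suc b)} \<subseteq> {k..max k N}"
      by (auto simp: k_def nat_le_iff ceiling_le_iff)
  qed auto
  also have "\<dots> \<le> 2 / real k - 1 / real (max k N)"
    by (rule sum_inverse_squares_tail) (use k in auto)
  also have "\<dots> \<le> 2 / real k" by simp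
  also have "\<dots> \<le> 2 / T" using k T by (intro divide_left_mono) auto
  finally show ?thesis .
qed

text \<open>The difference of the harmonic number and the logarithm is decreasing and equals 1 at n
  = 1.\<close>

lemma harm_le_ln: "n \<ge> 1 \<Longrightarrow> harm n \<le> 1 + ln (real n)"
proof -
  assume n: "n \<ge> 1"
  have "harm (Suc (n - 1)) - ln (real (Suc (n - 1))) \<le> harm (Suc 0) - ln (real (Suc 0))"
    using decseq_harm_diff_ln unfolding decseq_def by (metis le0)
  then show ?thesis using n by (simp add: harm_expand)
qed

lemma sum_inverse_le_ln:
  assumes T: "1 \<le> (T::real)"
  shows "(\<Sum>b | b < N \<and> real (Suc b) \<le> T. 1 / real (Suc b)) \<le> 1 + ln T"
proof -
  define k where "k = nat \<lfloor>T\<rfloor>"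
  have k: "real k \<le> T" "k \<ge> 1" using T by (auto simp: k_def) linarith+
  have "(\<Sum>b | b < N \<and> real (Suc b) \<le> T. 1 / real (Suc b)) \<le> (\<Sum>b<k. 1 / real (Suc b))"
  proof (intro sum_mono2)
    show "{b. b < N \<and> real (Suc b) \<le> T} \<subseteq> {..<k}"
      by (auto simp: k_def le_nat_iff le_floor_iff simp flip: Suc_le_eq)
  qed auto
  also have "\<dots> = harm k" by (simp add: harm_altdef inverse_eq_divide)
  also have "\<dots> \<le> 1 + ln (real k)" by (rule harm_le_ln[OF k(2)])
  also have "\<dots> \<le> 1 + ln T" using k by simp
  finally show ?thesis .
qed

section \<open>Two-sided bounds for \<open>prod_tail\<close>\<close>

lemma suminf_ennreal_le:
  assumes "\<And>b. f b \<le> ennreal (g b)" "\<And>b. 0 \<le> g b" "\<And>N. (\<Sum>b<N. g b) \<le> C"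
  shows "(\<Sum>b. f b) \<le> ennreal C"
proof -
  have "(\<Sum>b<N. f b) \<le> ennreal C" for N
  proof -
    have "(\<Sum>b<N. f b) \<le> (\<Sum>b<N. ennreal (g b))" by (intro sum_mono assms)
    also have "\<dots> = ennreal (\<Sum>b<N. g b)" using assms by simp
    also have "\<dots> \<le> ennreal C" by (intro ennreal_leI assms)
    finally show ?thesis .
  qed
  then show ?thesis by (intro suminf_le_const summableI)
qed

text \<open>Induction on the number of factors, splitting the values b of one factor at T = max 1 t.
  For b \<le> T the remaining threshold is T / b, and b^-2 times the inductive bound is of order 1 /
  (b T); the harmonic sum supplies one more logarithm. For b \<ge> T the remaining threshold is
  trivial and the tail of b^-2 gives 2 / T. The contributions 1 and 2 add up to the new factor 3.
  Working with \<open>max 1 t\<close> and \<open>1 + ln\<close> keeps the bound valid for every real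
  \<open>t\<close> and the logarithmic factor at least 1.\<close>

lemma prod_tail_upper_aux:
  "prod_tail (Suc d) t \<le> ennreal (3 ^ Suc d * (1 + ln (max 1 t)) ^ d / max 1 t)"
proof (induction d arbitrary: t)
  case 0
  define T where "T = max 1 t"
  have T: "1 \<le> T" by (simp add: T_def)
  have "prod_tail (Suc 0) t \<le> ennreal (2 / T)"
    unfolding prod_tail.simps
  proof (rule suminf_ennreal_le)
    fix b
    show "ennreal (1 / (real (Suc b))\<^sup>2) * (if t / real (Suc b) \<le> 1 then 1 else 0) \<le>
        ennreal (if T \<le> real (Suc b) then 1 / (real (Suc b))\<^sup>2 else 0)"
      by (auto simp: T_def field_simps)
  next
    fix N
    have "(\<Sum>b<N. if T \<le> real (Suc b) then 1 / (real (Suc b))\<^sup>2 else 0) =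
       (\<Sum>b | b < N \<and> T \<le> real (Suc b). 1 / (real (Suc b))\<^sup>2)"
      by (subst sum.inter_filter[symmetric]) auto
    also have "\<dots> \<le> 2 / T" by (rule sum_inverse_squares_gt[OF T])
    finally show "(\<Sum>b<N. if T \<le> real (Suc b) then 1 / (real (Suc b))\<^sup>2 else 0) \<le> 2 / T" .
  qed auto
  also have "\<dots> \<le> ennreal (3 ^ Suc 0 * (1 + ln (max 1 t)) ^ 0 / max 1 t)"
    unfolding T_def[symmetric] using T by (intro ennreal_leI) (simp add: divide_right_mono)
  finally show ?case .
next
  case (Suc d)
  define T where "T = max 1 t"
  have T: "1 \<le> T" by (simp add: T_def)
  define L where "L = 1 + ln T"
  have L: "1 \<le> L" using T by (simp add: L_def)
  define K where "K = (3::real) ^ Suc d"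
  have K: "K > 0" by (simp add: K_def)
  \<comment> \<open>Both regimes are summed; at equality both terms are present, which is harmless
    for an upper bound.\<close>
  define g where "g b = (if real (Suc b) \<le> T then K * L ^ d / T * (1 / real (Suc b)) else 0) +
       (if T \<le> real (Suc b) then K * (1 / (real (Suc b))\<^sup>2) else 0)" for b
  have "prod_tail (Suc (Suc d)) t \<le> ennreal (K * L ^ d / T * (1 + ln T) + K * (2 / T))"
    unfolding prod_tail.simps(2)[of "Suc d"]
  proof (rule suminf_ennreal_le[where g=g])
    show "0 \<le> g b" for b using K L T by (simp add: g_def)
  next
    fix b
    let ?b = "real (Suc b)"
    have b: "?b \<ge> 1" by simp
    have "ennreal (1 / ?b\<^sup>2) * prod_tail (Suc d) (t / ?b) \<le>
        ennreal (1 / ?b\<^sup>2) * ennreal (K * (1 + ln (max 1 (t / ?b))) ^ d / max 1 (t / ?b))"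
      unfolding K_def by (intro mult_left_mono Suc.IH) auto
    also have "\<dots> = ennreal (1 / ?b\<^sup>2 * (K * (1 + ln (max 1 (t / ?b))) ^ d / max 1 (t / ?b)))"
      by (rule ennreal_mult'[symmetric]) simp
    also have "\<dots> \<le> ennreal (g b)"
    proof (rule ennreal_leI)
      show "1 / ?b\<^sup>2 * (K * (1 + ln (max 1 (t / ?b))) ^ d / max 1 (t / ?b)) \<le> g b"
      proof (cases "?b \<le> T")
        case True
        \<comment> \<open>When t \<le> 1, the assumption \<open>?b \<le> T\<close> forces
          \<open>?b = 1\<close>, so the truncation at 1 commutes with the division.\<close>
        have m: "max 1 (t / ?b) = T / ?b"
        proof (cases "t \<le> 1")
          case True
          with \<open>?b \<le> T\<close> b have "T = 1" "?b = 1" by (auto simp: T_def)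
          then show ?thesis using True by simp
        next
          case False
          then show ?thesis using \<open>?b \<le> T\<close> b by (auto simp: T_def field_simps max_def)
        qed
        have "T / ?b \<le> T / 1" using T b by (intro divide_left_mono) auto
        then have "1 + ln (T / ?b) \<le> L" using T b unfolding L_def
          by (intro add_left_mono ln_mono) auto
        moreover have "0 \<le> 1 + ln (T / ?b)" using True b by (simp add: ln_ge_zero add_nonneg_nonneg)
        ultimately have "(1 + ln (T / ?b)) ^ d \<le> L ^ d" by (rule power_mono)
        then have "1 / ?b\<^sup>2 * (K * (1 + ln (T / ?b)) ^ d / (T / ?b)) \<le> 1 / ?b\<^sup>2 * (K * L ^ d / (T / ?b))"
          using K T b by (intro mult_left_mono divide_right_mono) auto
        also have "\<dots> = K * L ^ d / T * (1 / ?b)"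
          using b T by (simp add: field_simps power2_eq_square del: of_nat_Suc)
        also have "\<dots> \<le> g b" using True K by (simp add: g_def)
        finally show ?thesis unfolding m .
      next
        case False
        then have "max 1 (t / ?b) = 1" by (auto simp: T_def field_simps max_def)
        then show ?thesis using False by (simp add: g_def)
      qed
    qed
    finally show "ennreal (1 / ?b\<^sup>2) * prod_tail (Suc d) (t / ?b) \<le> ennreal (g b)" .
  next
    fix N
    have "(\<Sum>b<N. g b) = K * L ^ d / T * (\<Sum>b | b < N \<and> real (Suc b) \<le> T. 1 / real (Suc b)) +
       K * (\<Sum>b | b < N \<and> T \<le> real (Suc b). 1 / (real (Suc b))\<^sup>2)"
      unfolding g_def sum.distrib
      by (simp add: sum.inter_filter[symmetric] sum_distrib_left lessThan_def conj_commute del: of_nat_Suc)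
    also have "\<dots> \<le> K * L ^ d / T * (1 + ln T) + K * (2 / T)"
      using K L T by (intro add_mono mult_left_mono sum_inverse_squares_gt sum_inverse_le_ln) auto
    finally show "(\<Sum>b<N. g b) \<le> K * L ^ d / T * (1 + ln T) + K * (2 / T)" .
  qed
  also have "\<dots> \<le> ennreal (3 ^ Suc (Suc d) * (1 + ln (max 1 t)) ^ Suc d / max 1 t)"
    unfolding T_def[symmetric] L_def[symmetric]
  proof (rule ennreal_leI)
    have "1 \<le> L ^ Suc d" using L by (rule one_le_power)
    then have "K * (2 / T) \<le> K * (2 * L ^ Suc d / T)"
      using K T by (intro mult_left_mono divide_right_mono) auto
    moreover have "3 ^ Suc (Suc d) * L ^ Suc d / T = K * L ^ d / T * L + K * (2 * L ^ Suc d / T)"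
      using T by (simp add: K_def field_simps)
    ultimately show "K * L ^ d / T * L + K * (2 / T) \<le> 3 ^ Suc (Suc d) * L ^ Suc d / T"
      by linarith
  qed
  finally show ?case .
qed

text \<open>For t \<ge> 2 the logarithm is at least ln 2, so the summand 1 in
  \<open>1 + ln t\<close> is absorbed into a constant multiple of \<open>ln t\<close>.\<close>

lemma prod_tail_upper:
  obtains C where "C > 0" "\<And>t. t \<ge> 2 \<Longrightarrow> prod_tail (Suc d) t \<le> ennreal (C * (ln t ^ d / t))"
proof
  let ?c = "1 + 1 / ln 2 :: real"
  show "3 ^ Suc d * ?c ^ d > (0::real)"
    by (intro mult_pos_pos zero_less_power add_pos_pos) auto
  fix t :: real assume t: "t \<ge> 2"
  have "ln 2 \<le> ln t" using t by simp
  then have "1 \<le> ln t / ln 2" by simp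
  then have "1 + ln t \<le> ?c * ln t" by (simp add: algebra_simps)
  then have "(1 + ln t) ^ d \<le> (?c * ln t) ^ d" using t by (intro power_mono) auto
  then have "3 ^ Suc d * (1 + ln t) ^ d / t \<le> 3 ^ Suc d * (?c * ln t) ^ d / t"
    using t by (intro divide_right_mono mult_left_mono) auto
  also have "\<dots> = 3 ^ Suc d * ?c ^ d * (ln t ^ d / t)" by (simp add: power_mult_distrib)
  finally show "prod_tail (Suc d) t \<le> ennreal (3 ^ Suc d * ?c ^ d * (ln t ^ d / t))"
    using prod_tail_upper_aux[of d t] t by (auto intro: order_trans ennreal_leI simp: max_def)
qed

lemma le_suminf_ennreal:
  assumes "\<And>b. b \<in> B \<Longrightarrow> ennreal (g b) \<le> f b" "\<And>b. b \<in> B \<Longrightarrow> 0 \<le> g b" "finite B" "C \<le> (\<Sum>b\<in>B. g b)"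
  shows "ennreal C \<le> (\<Sum>b. f b)"
proof -
  have "ennreal C \<le> ennreal (\<Sum>b\<in>B. g b)" by (intro ennreal_leI assms)
  also have "\<dots> = (\<Sum>b\<in>B. ennreal (g b))" using assms by simp
  also have "\<dots> \<le> (\<Sum>b\<in>B. f b)" by (intro sum_mono assms)
  also have "\<dots> \<le> (\<Sum>b. f b)" using assms by (intro sum_le_suminf) auto
  finally show ?thesis .
qed

text \<open>For one factor, the k = \<lceil>t\<rceil> integers from k + 1 to 2k each weigh at least
  1 / (4 k^2), and k \<le> 2t. For the step, only factors up to sqrt t are kept: the remaining
  threshold is then at least sqrt t, whose logarithm is half of \<open>ln t\<close>, and the
  harmonic sum up to sqrt t gives another half of \<open>ln t\<close>. This explains the powers of 2
  lost.\<close>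

lemma prod_tail_lower:
  "\<exists>c>0. \<forall>t\<ge>1. ennreal (c * (ln t ^ d / t)) \<le> prod_tail (Suc d) t"
proof (induction d)
  case 0
  have "ennreal (1/8 * (ln t ^ 0 / t)) \<le> prod_tail (Suc 0) t" if t: "t \<ge> 1" for t :: real
    unfolding prod_tail.simps
  proof (rule le_suminf_ennreal)
    define k where "k = nat \<lceil>t\<rceil>"
    have k: "t \<le> real k" "real k \<le> 2 * t" "k \<ge> 1" using t by (auto simp: k_def) linarith+
    show "finite {k..<2*k}" by simp
    fix b assume b: "b \<in> {k..<2*k}"
    then show "0 \<le> 1 / (4 * (real k)\<^sup>2)" by simp
    have "real (Suc b) \<le> 2 * real k" using b by simp
    then have "(real (Suc b))\<^sup>2 \<le> (2 * real k)\<^sup>2" by (intro power_mono) auto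
    then have "1 / (4 * (real k)\<^sup>2) \<le> 1 / (real (Suc b))\<^sup>2"
      using k by (intro divide_left_mono mult_pos_pos) (auto simp: power_mult_distrib)
    moreover have "t / real (Suc b) \<le> 1" using b k by simp
    ultimately show "ennreal (1 / (4 * (real k)\<^sup>2)) \<le>
        ennreal (1 / (real (Suc b))\<^sup>2) * (if t / real (Suc b) \<le> 1 then 1 else 0)"
      by (simp add: ennreal_leI)
  next
    show "1/8 * (ln t ^ 0 / t) \<le> (\<Sum>b\<in>{nat \<lceil>t\<rceil>..<2 * nat \<lceil>t\<rceil>}. 1 / (4 * (real (nat \<lceil>t\<rceil>))\<^sup>2))"
    proof -
      define k where "k = nat \<lceil>t\<rceil>"
      have k: "t \<le> real k" "real k \<le> 2 * t" "k \<ge> 1" using t by (auto simp: k_def) linarith+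
      have "1 / (8 * t) \<le> 1 / (4 * real k)" using k t by (intro divide_left_mono) auto
      then show ?thesis unfolding k_def[symmetric] using k by (simp add: field_simps power2_eq_square)
    qed
  qed
  then show ?case by (intro exI[of _ "1/8"]) auto
next
  case (Suc d)
  then obtain c where c: "c > 0" and
    IH: "\<And>t. t \<ge> 1 \<Longrightarrow> ennreal (c * (ln t ^ d / t)) \<le> prod_tail (Suc d) t" by auto
  have "ennreal (c / 2 ^ Suc d * (ln t ^ Suc d / t)) \<le> prod_tail (Suc (Suc d)) t" if t: "t \<ge> 1" for t
    unfolding prod_tail.simps(2)[of "Suc d"]
  proof (rule le_suminf_ennreal)
    define k where "k = nat \<lfloor>sqrt t\<rfloor>"
    show "finite {..<k}" by simp
    have l: "ln (sqrt t) = ln t / 2" "0 \<le> ln t" using t by (auto simp: ln_sqrt)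
    have k: "sqrt t \<le> real k + 1" "real k \<le> sqrt t" using t by (auto simp: k_def)
    {
      fix b
      show "0 \<le> c * (ln t / 2) ^ d / t * (1 / real (Suc b))" using c l t by simp
      assume b: "b \<in> {..<k}"
      then have "real (Suc b) \<le> real k" by (simp del: of_nat_Suc)
      then have b': "real (Suc b) \<le> sqrt t" using k by simp
      have st: "sqrt t * sqrt t = t" "sqrt t \<ge> 1" using t by auto
      have "sqrt t * real (Suc b) \<le> sqrt t * sqrt t" using b' t by (intro mult_left_mono) auto
      then have tb: "sqrt t \<le> t / real (Suc b)" using st by (simp add: field_simps)
      then have tb1: "1 \<le> t / real (Suc b)" using st by linarith
      have "ln (sqrt t) \<le> ln (t / real (Suc b))" using tb st by (intro ln_mono) auto
      then have "(ln t / 2) ^ d \<le> ln (t / real (Suc b)) ^ d" using l by (intro power_mono) auto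
      then have "c * ((ln t / 2) ^ d / (t / real (Suc b))) \<le> c * (ln (t / real (Suc b)) ^ d / (t / real (Suc b)))"
        using c t by (intro mult_left_mono divide_right_mono) auto
      then have "ennreal (c * ((ln t / 2) ^ d / (t / real (Suc b)))) \<le> prod_tail (Suc d) (t / real (Suc b))"
        using IH[OF tb1] by (auto intro: order_trans ennreal_leI)
      then have "ennreal (1 / (real (Suc b))\<^sup>2) * ennreal (c * ((ln t / 2) ^ d / (t / real (Suc b)))) \<le>
          ennreal (1 / (real (Suc b))\<^sup>2) * prod_tail (Suc d) (t / real (Suc b))"
        by (rule mult_left_mono) simp
      moreover have "1 / (real (Suc b))\<^sup>2 * (c * ((ln t / 2) ^ d / (t / real (Suc b)))) =
          c * (ln t / 2) ^ d / t * (1 / real (Suc b))"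
        using t by (simp add: field_simps power2_eq_square del: of_nat_Suc)
      ultimately show "ennreal (c * (ln t / 2) ^ d / t * (1 / real (Suc b))) \<le>
          ennreal (1 / (real (Suc b))\<^sup>2) * prod_tail (Suc d) (t / real (Suc b))"
        by (simp add: ennreal_mult'[symmetric] del: of_nat_Suc)
    }
    have "ln t / 2 \<le> ln (real k + 1)" unfolding l(1)[symmetric] using k t by (intro ln_mono) auto
    also have "\<dots> \<le> harm k" by (rule ln_le_harm)
    also have "\<dots> = (\<Sum>b<k. 1 / real (Suc b))" by (simp add: harm_altdef inverse_eq_divide)
    finally have "c * (ln t / 2) ^ d / t * (ln t / 2) \<le> c * (ln t / 2) ^ d / t * (\<Sum>b<k. 1 / real (Suc b))"
      using c l t by (intro mult_left_mono) auto
    moreover have "c / 2 ^ Suc d * (ln t ^ Suc d / t) = c * (ln t / 2) ^ d / t * (ln t / 2)"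
      using t by (simp add: field_simps power_divide)
    ultimately show "c / 2 ^ Suc d * (ln t ^ Suc d / t) \<le> (\<Sum>b<k. c * (ln t / 2) ^ d / t * (1 / real (Suc b)))"
      by (simp add: sum_distrib_left)
  qed
  then show ?case using c by (intro exI[of _ "c / 2 ^ Suc d"]) auto
qed

section \<open>Peeling digits off a product, smallest index first\<close>

lemma emeasure_split_digit:
  assumes "{x \<in> A. P x} \<in> sets irr_measure" "A \<subseteq> irr_unit"
  shows "emeasure irr_measure {x \<in> A. P x} =
    (\<Sum>b. emeasure irr_measure {x \<in> {x \<in> A. cf_a j x = Suc b}. P x})"
proof -
  have S: "{x \<in> {x \<in> A. cf_a j x = b}. P x} \<in> sets irr_measure" for b
  proof -
    have "{x \<in> space irr_measure. cf_a j x = b} \<in> sets irr_measure" by measurable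
    from sets.Int[OF this assms(1)] show ?thesis
      by (rule back_subst[where P="\<lambda>A. A \<in> sets irr_measure"]) (use assms(2) in auto)
  qed
  have "{x \<in> A. P x} = (\<Union>b. {x \<in> {x \<in> A. cf_a j x = Suc b}. P x})"
  proof -
    have "\<exists>b. cf_a j x = Suc b" if "x \<in> A" for x
      using cf_a_pos[of x j] assms(2) that by (cases "cf_a j x") auto
    then show ?thesis by auto
  qed
  also have "emeasure irr_measure \<dots> = (\<Sum>b. emeasure irr_measure {x \<in> {x \<in> A. cf_a j x = Suc b}. P x})"
    by (subst suminf_emeasure) (use S in \<open>auto simp: disjoint_family_on_def\<close>)
  finally show ?thesis .
qed

lemma prod_digits_sets:
  assumes "A \<in> sets irr_measure"
  shows "{x \<in> A. t \<le> real (\<Prod>j\<in>J. cf_a j x) \<and> s \<le> real (\<Prod>j\<in>K. cf_a j x)} \<in> sets irr_measure"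
proof -
  have "{x \<in> space irr_measure. t \<le> real (\<Prod>j\<in>J. cf_a j x) \<and> s \<le> real (\<Prod>j\<in>K. cf_a j x)} \<in> sets irr_measure"
    unfolding of_nat_prod by measurable
  from sets.Int[OF this assms] show ?thesis
    by (rule back_subst[where P="\<lambda>A. A \<in> sets irr_measure"])
      (use sets.sets_into_space[OF assms] in auto)
qed

lemma le_prod_remove:
  assumes "finite J" "j \<in> J" "cf_a j x = Suc b"
  shows "t \<le> real (\<Prod>i\<in>J. cf_a i x) \<longleftrightarrow> t / real (Suc b) \<le> real (\<Prod>i\<in>J - {j}. cf_a i x)"
proof -
  have "(\<Prod>i\<in>J. cf_a i x) = Suc b * (\<Prod>i\<in>J - {j}. cf_a i x)"
    using assms by (simp add: prod.remove)
  then show ?thesis by (simp add: field_simps del: of_nat_Suc mult_Suc)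
qed

text \<open>Induction on the total number of digits. Fixing the digit at the smallest index
  \<open>j\<close> gives an event of the first \<open>j\<close> digits, and all remaining indices
  exceed \<open>j\<close>, so the induction hypothesis applies with \<open>j\<close> in place of
  \<open>m\<close>. Disjointness ensures that only one threshold is divided by the digit, following
  the recursion of \<open>prod_tail\<close>; each digit costs a factor 2 from
  \<open>digit_ratio\<close>.\<close>

lemma two_products_upper:
  assumes "finite J" "finite K" "J \<inter> K = {}" "\<And>j. j \<in> J \<union> K \<Longrightarrow> m < j" "cf_event m A"
  shows "emeasure irr_measure {x \<in> A. t \<le> real (\<Prod>j\<in>J. cf_a j x) \<and> s \<le> real (\<Prod>j\<in>K. cf_a j x)}
    \<le> 2 ^ (card J + card K) * (prod_tail (card J) t * prod_tail (card K) s) * emeasure irr_measure A"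
  using assms
proof (induction "card (J \<union> K)" arbitrary: J K m A s t)
  case 0
  then have "J = {}" "K = {}" by auto
  then show ?case by auto
next
  case (Suc n)
  \<comment> \<open>Stated for arbitrary \<open>J\<close>, \<open>K\<close>, \<open>t\<close>,
    \<open>s\<close> with the minimum in \<open>J\<close>, so that the other case follows by
    exchanging the two products.\<close>
  have step: "emeasure irr_measure {x \<in> A. t \<le> real (\<Prod>j\<in>J. cf_a j x) \<and> s \<le> real (\<Prod>j\<in>K. cf_a j x)}
    \<le> 2 ^ (card J + card K) * (prod_tail (card J) t * prod_tail (card K) s) * emeasure irr_measure A"
    if n: "Suc n = card (J \<union> K)" and fin: "finite J" "finite K" and disj: "J \<inter> K = {}"
      and min: "j \<in> J" "\<And>i. i \<in> J \<union> K \<Longrightarrow> j \<le> i" and jm: "m < j" for J K j and t s :: real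
  proof -
    define J' where "J' = J - {j}"
    have J': "finite J'" "J' \<inter> K = {}" "\<And>i. i \<in> J' \<union> K \<Longrightarrow> j < i" "card J = Suc (card J')"
      using fin disj min card.remove[OF fin(1) min(1)] by (auto simp: J'_def order_less_le)
    have "J \<union> K = insert j (J' \<union> K)" "j \<notin> J' \<union> K" using min disj by (auto simp: J'_def)
    then have n': "n = card (J' \<union> K)" using n fin J' by simp
    note Asets = cf_event_sets[OF Suc.prems(5)]
    have Asub: "A \<subseteq> irr_unit" using sets.sets_into_space[OF Asets] by simp
    have "emeasure irr_measure {x \<in> A. t \<le> real (\<Prod>j\<in>J. cf_a j x) \<and> s \<le> real (\<Prod>j\<in>K. cf_a j x)} =
      (\<Sum>b. emeasure irr_measure {x \<in> {x \<in> A. cf_a j x = Suc b}.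
         t \<le> real (\<Prod>j\<in>J. cf_a j x) \<and> s \<le> real (\<Prod>j\<in>K. cf_a j x)})"
      by (rule emeasure_split_digit[OF prod_digits_sets[OF Asets] Asub])
    also have "\<dots> \<le> (\<Sum>b. 2 ^ (card J + card K) * (prod_tail (card K) s * emeasure irr_measure A) *
        (ennreal (1 / (real (Suc b))\<^sup>2) * prod_tail (card J') (t / real (Suc b))))"
    proof (rule suminf_le)
      fix b
      let ?A = "{x \<in> A. cf_a j x = Suc b}"
      have "{x \<in> ?A. t \<le> real (\<Prod>j\<in>J. cf_a j x) \<and> s \<le> real (\<Prod>j\<in>K. cf_a j x)} =
         {x \<in> ?A. t / real (Suc b) \<le> real (\<Prod>j\<in>J'. cf_a j x) \<and> s \<le> real (\<Prod>j\<in>K. cf_a j x)}"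
        unfolding J'_def by (intro Collect_cong) (use le_prod_remove[OF fin(1) min(1), of _ b t] in auto)
      also have "emeasure irr_measure \<dots> \<le>
        2 ^ (card J' + card K) * (prod_tail (card J') (t / real (Suc b)) * prod_tail (card K) s) * emeasure irr_measure ?A"
        by (intro Suc.hyps(1)[OF n' J'(1) fin(2) J'(2,3)] cf_event_digit[OF Suc.prems(5) jm])
      also have "\<dots> \<le> 2 ^ (card J' + card K) * (prod_tail (card J') (t / real (Suc b)) * prod_tail (card K) s) *
          (ennreal (2 / (real (Suc b))\<^sup>2) * emeasure irr_measure A)"
        by (intro mult_left_mono digit_ratio(1)[OF Suc.prems(5) jm]) auto
      also have "ennreal (2 / (real (Suc b))\<^sup>2) = 2 * ennreal (1 / (real (Suc b))\<^sup>2)"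
        using ennreal_mult'[of 2 "1 / (real (Suc b))\<^sup>2"] by simp
      finally show "emeasure irr_measure {x \<in> ?A. t \<le> real (\<Prod>j\<in>J. cf_a j x) \<and> s \<le> real (\<Prod>j\<in>K. cf_a j x)}
        \<le> 2 ^ (card J + card K) * (prod_tail (card K) s * emeasure irr_measure A) *
        (ennreal (1 / (real (Suc b))\<^sup>2) * prod_tail (card J') (t / real (Suc b)))"
        by (simp only: J'(4) mult_ac power_Suc add_Suc)
    qed auto
    also have "\<dots> = 2 ^ (card J + card K) * (prod_tail (card J) t * prod_tail (card K) s) * emeasure irr_measure A"
      unfolding ennreal_suminf_cmult J'(4) prod_tail.simps(2) by (simp only: mult_ac)
    finally show ?thesis .
  qed
  define j where "j = Min (J \<union> K)"
  have ne: "J \<union> K \<noteq> {}" using Suc.hyps(2) by (metis card.empty nat.distinct(1))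
  have fin: "finite (J \<union> K)" using Suc.prems by simp
  have j: "j \<in> J \<union> K" "\<And>i. i \<in> J \<union> K \<Longrightarrow> j \<le> i"
    using Min_in[OF fin ne] Min_le[OF fin] by (auto simp: j_def)
  have jm: "m < j" using j Suc.prems(4) by blast
  show ?case
  proof (cases "j \<in> J")
    case True
    show ?thesis by (rule step[OF Suc.hyps(2) Suc.prems(1,2,3) True j(2) jm])
  next
    case False
    then have jK: "j \<in> K" using j by auto
    have "Suc n = card (K \<union> J)" "K \<inter> J = {}" "\<And>i. i \<in> K \<union> J \<Longrightarrow> j \<le> i"
      using Suc.hyps(2) Suc.prems(3) j(2) by (auto simp: Un_commute Int_commute)
    from step[OF this(1) Suc.prems(2,1) this(2) jK this(3) jm, of s t]
    show ?thesis by (simp add: conj_commute mult_ac add.commute)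
  qed
qed

text \<open>The same peeling with the lower constant 1/4 per digit. A single product suffices, since
  the second moment argument uses lower bounds only for individual events.\<close>

lemma product_lower:
  assumes "finite J" "\<And>j. j \<in> J \<Longrightarrow> m < j" "cf_event m A"
  shows "ennreal (1/4) ^ card J * prod_tail (card J) t * emeasure irr_measure A
    \<le> emeasure irr_measure {x \<in> A. t \<le> real (\<Prod>j\<in>J. cf_a j x)}"
  using assms
proof (induction "card J" arbitrary: J m A t)
  case 0
  then have "J = {}" by auto
  then show ?case by auto
next
  case (Suc n)
  define j where "j = Min J"
  have ne: "J \<noteq> {}" using Suc.hyps(2) by auto
  have j: "j \<in> J" "\<And>i. i \<in> J \<Longrightarrow> j \<le> i"
    using Min_in[OF Suc.prems(1) ne] Min_le[OF Suc.prems(1)] by (auto simp: j_def)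
  have jm: "m < j" using j Suc.prems by blast
  define J' where "J' = J - {j}"
  have J': "finite J'" "\<And>i. i \<in> J' \<Longrightarrow> j < i" "card J = Suc (card J')"
    using j Suc.prems(1) card.remove[OF Suc.prems(1) j(1)] by (auto simp: J'_def order_less_le)
  then have n': "n = card J'" using Suc.hyps(2) by simp
  note Asets = cf_event_sets[OF Suc.prems(3)]
  have Asub: "A \<subseteq> irr_unit" using sets.sets_into_space[OF Asets] by simp
  have sets: "{x \<in> A. t \<le> real (\<Prod>j\<in>J. cf_a j x)} \<in> sets irr_measure"
    using prod_digits_sets[OF Asets, of t J 0 "{}"] by simp
  have "ennreal (1/4) ^ card J * prod_tail (card J) t * emeasure irr_measure A =
     (\<Sum>b. ennreal (1/4) ^ card J * emeasure irr_measure A *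
        (ennreal (1 / (real (Suc b))\<^sup>2) * prod_tail (card J') (t / real (Suc b))))"
    unfolding ennreal_suminf_cmult J'(3) prod_tail.simps(2) by (simp only: mult_ac)
  also have "\<dots> \<le> (\<Sum>b. emeasure irr_measure {x \<in> {x \<in> A. cf_a j x = Suc b}. t \<le> real (\<Prod>j\<in>J. cf_a j x)})"
  proof (rule suminf_le)
    fix b
    let ?A = "{x \<in> A. cf_a j x = Suc b}"
    have "ennreal (1 / (4 * (real (Suc b))\<^sup>2)) = ennreal (1/4) * ennreal (1 / (real (Suc b))\<^sup>2)"
      using ennreal_mult'[of "1/4" "1 / (real (Suc b))\<^sup>2"] by simp
    then have "ennreal (1/4) ^ card J * emeasure irr_measure A *
        (ennreal (1 / (real (Suc b))\<^sup>2) * prod_tail (card J') (t / real (Suc b))) =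
       ennreal (1/4) ^ card J' * prod_tail (card J') (t / real (Suc b)) *
         (ennreal (1 / (4 * (real (Suc b))\<^sup>2)) * emeasure irr_measure A)"
      by (simp only: J'(3) mult_ac power_Suc)
    also have "\<dots> \<le> ennreal (1/4) ^ card J' * prod_tail (card J') (t / real (Suc b)) * emeasure irr_measure ?A"
      by (intro mult_left_mono digit_ratio(2)[OF Suc.prems(3) jm]) auto
    also have "\<dots> \<le> emeasure irr_measure {x \<in> ?A. t / real (Suc b) \<le> real (\<Prod>j\<in>J'. cf_a j x)}"
      by (intro Suc.hyps(1)[OF n' J'(1,2)] cf_event_digit[OF Suc.prems(3) jm])
    also have "{x \<in> ?A. t / real (Suc b) \<le> real (\<Prod>j\<in>J'. cf_a j x)} = {x \<in> ?A. t \<le> real (\<Prod>j\<in>J. cf_a j x)}"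
      unfolding J'_def by (intro Collect_cong) (use le_prod_remove[OF Suc.prems(1) j(1), of _ b t] in auto)
    finally show "ennreal (1/4) ^ card J * emeasure irr_measure A *
        (ennreal (1 / (real (Suc b))\<^sup>2) * prod_tail (card J') (t / real (Suc b))) \<le>
      emeasure irr_measure {x \<in> ?A. t \<le> real (\<Prod>j\<in>J. cf_a j x)}" .
  qed auto
  also have "\<dots> = emeasure irr_measure {x \<in> A. t \<le> real (\<Prod>j\<in>J. cf_a j x)}"
    by (rule emeasure_split_digit[OF sets Asub, symmetric])
  finally show ?case .
qed

section \<open>Full measure from uniform density\<close>

lemma inverse_eq_cf_a_plus_gauss:
  assumes "x \<in> irr_unit" shows "1 / x = real (cf_a 1 x) + gauss x"
proof -
  have "1 \<le> 1 / x" using irr_unit_bounds[OF assms] by (simp add: field_simps)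
  then have "0 \<le> \<lfloor>1 / x\<rfloor>" by linarith
  then show ?thesis by (simp add: cf_a_def gauss_def frac_def)
qed

lemma dist_gauss:
  assumes x: "x \<in> irr_unit" and y: "y \<in> irr_unit" and "cf_a 1 x = cf_a 1 y"
  shows "\<bar>x - y\<bar> = x * y * \<bar>gauss x - gauss y\<bar>"
proof -
  have "gauss x - gauss y = 1 / x - 1 / y"
    using inverse_eq_cf_a_plus_gauss[OF x] inverse_eq_cf_a_plus_gauss[OF y] assms(3) by simp
  moreover have "x > 0" "y > 0" using irr_unit_bounds x y by auto
  then have "x - y = x * y * (1 / y - 1 / x)" by (simp add: field_simps)
  ultimately have "x - y = x * y * - (gauss x - gauss y)" by simp
  then show ?thesis using \<open>x > 0\<close> \<open>y > 0\<close> by (simp add: abs_mult abs_minus_commute)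
qed

text \<open>The integer part of 1 / x is at least 1 and \<open>gauss x\<close> is below 1, so 1 / x
  is at least twice \<open>gauss x\<close>. A single factor \<open>x\<close> may be close to 1;
  contraction is uniform only over two Gauss steps.\<close>

lemma mult_gauss_le_half:
  assumes x: "x \<in> irr_unit" shows "x * gauss x \<le> 1 / 2"
proof -
  have "x > 0" "gauss x < 1" using irr_unit_bounds x gauss_irr_unit by auto
  moreover have "real (cf_a 1 x) \<ge> 1" using cf_a_pos[OF x, of 1] by simp
  ultimately have "2 * gauss x \<le> 1 / x" using inverse_eq_cf_a_plus_gauss[OF x] by linarith
  then show ?thesis using \<open>x > 0\<close> by (simp add: field_simps)
qed

lemma cf_prefix_Suc_Cons: "cf_prefix (Suc m) x = cf_a 1 x # cf_prefix m (gauss x)"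
proof -
  have "cf_a (Suc (Suc i)) x = cf_a (Suc i) (gauss x)" for i
    by (simp add: cf_a_Suc funpow_Suc_right del: funpow.simps)
  moreover have "[0..<Suc m] = 0 # map Suc [0..<m]" by (simp add: upt_conv_Cons map_Suc_upt del: upt_Suc)
  ultimately show ?thesis by (simp add: cf_prefix_def del: upt_Suc)
qed

text \<open>Two common digits multiply the distance by \<open>x * gauss x\<close> and
  \<open>y * gauss y\<close>. The first product is at most 1/2 and the second at most 1, hence one
  halving for every two digits.\<close>

lemma cylinder_diameter:
  assumes "x \<in> irr_unit" "y \<in> irr_unit" "cf_prefix (2 * k) x = cf_prefix (2 * k) y"
  shows "\<bar>x - y\<bar> \<le> (1 / 2) ^ k"
  using assms
proof (induction k arbitrary: x y)
  case 0
  then show ?case using irr_unit_bounds[of x] irr_unit_bounds[of y] by auto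
next
  case (Suc k)
  let ?x = "gauss x" and ?y = "gauss y"
  have g: "?x \<in> irr_unit" "?y \<in> irr_unit" "gauss ?x \<in> irr_unit" "gauss ?y \<in> irr_unit"
    using Suc.prems gauss_irr_unit by auto
  have eq: "cf_a 1 x = cf_a 1 y" "cf_a 1 ?x = cf_a 1 ?y"
      "cf_prefix (2 * k) (gauss ?x) = cf_prefix (2 * k) (gauss ?y)"
    using Suc.prems(3) by (auto simp: cf_prefix_Suc_Cons)
  have pos: "0 < x" "0 < ?x" "0 < y" "0 < ?y" "y < 1" "?y < 1"
    using irr_unit_bounds Suc.prems g by auto
  have "\<bar>x - y\<bar> = (x * ?x) * (y * ?y) * \<bar>gauss ?x - gauss ?y\<bar>"
    using dist_gauss[OF Suc.prems(1,2) eq(1)] dist_gauss[OF g(1,2) eq(2)] by simp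
  also have "\<dots> \<le> (1 / 2 * 1) * (1 / 2) ^ k"
    using pos mult_gauss_le_half[OF Suc.prems(1)] Suc.IH[OF g(3,4) eq(3)]
    by (intro mult_mono mult_le_one) auto
  finally show ?case by simp
qed

text \<open>A substitute for the Lebesgue density theorem: exhaust an open neighbourhood of the
  complement by cylinders.\<close>
lemma full_measure_of_uniform_density:
  assumes V: "V \<in> sets irr_measure" and c: "c > 0"
    and dens: "\<And>m A. cf_event m A \<Longrightarrow> c * measure irr_measure A \<le> measure irr_measure (A \<inter> V)"
  shows "measure irr_measure (irr_unit - V) = 0"
proof -
  define B where "B = irr_unit - V"
  have B: "B \<in> sets irr_measure" "B \<in> sets borel"
    using V by (auto simp: B_def in_sets_irr_measure)
  have "measure irr_measure B \<le> e" if e: "e > 0" for e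
  proof -
    obtain U where U: "open U" "B \<subseteq> U" "emeasure lborel (U - B) < ennreal (c * e)"
      using outer_regular_lborel[of B "c * e"] B c e by auto
    \<comment> \<open>The union of all depth \<open>m\<close> cylinders contained in
      \<open>U\<close>. These sets increase with \<open>m\<close>, and together they cover
      \<open>B\<close> because cylinders shrink and \<open>U\<close> is open.\<close>
    define A where "A m = {x \<in> irr_unit. cf_prefix m x \<in> {w. {y \<in> irr_unit. cf_prefix m y = w} \<subseteq> U}}" for m
    have ev: "cf_event m (A m)" for m unfolding cf_event_def A_def by blast
    note As = cf_event_sets[OF ev]
    have "measure irr_measure (A m) \<le> e" for m
    proof -
      \<comment> \<open>The part of \<open>A m\<close> in \<open>V\<close> misses \<open>B\<close>,
        so its measure is below \<open>c * e\<close>; the density hypothesis turns this into the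
        bound \<open>e\<close> for \<open>A m\<close> itself.\<close>
      have sub: "A m \<inter> V \<subseteq> U - B" by (auto simp: A_def B_def)
      have "emeasure irr_measure (A m \<inter> V) = emeasure lborel (A m \<inter> V)"
        by (rule emeasure_irr_measure) (auto simp: A_def)
      also have "\<dots> \<le> emeasure lborel (U - B)"
        using sub B U by (intro emeasure_mono) auto
      also have "\<dots> \<le> ennreal (c * e)" using U by simp
      finally have "measure irr_measure (A m \<inter> V) \<le> c * e"
        using c e by (simp add: irr.emeasure_eq_measure)
      with dens[OF ev, of m] have "c * measure irr_measure (A m) \<le> c * e" by linarith
      then show ?thesis using c by simp
    qed
    moreover have "(\<lambda>m. measure irr_measure (A m)) \<longlonglongrightarrow> measure irr_measure (\<Union>m. A m)"
    proof (rule irr.finite_Lim_measure_incseq)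
      show "range A \<subseteq> sets irr_measure" using As by auto
      show "incseq A" by (rule incseq_SucI) (auto simp: A_def cf_prefix_Suc)
    qed
    ultimately have "measure irr_measure (\<Union>m. A m) \<le> e"
      by (intro LIMSEQ_le_const2) auto
    moreover have "B \<subseteq> (\<Union>m. A m)"
    proof
      fix x assume x: "x \<in> B"
      then have xi: "x \<in> irr_unit" by (simp add: B_def)
      obtain r where r: "r > 0" "ball x r \<subseteq> U" using U x by (meson open_contains_ball subsetD)
      obtain k where k: "(1 / 2 :: real) ^ k < r"
        using real_arch_pow_inv[OF r(1), of "1/2"] by auto
      have "y \<in> U" if "y \<in> irr_unit" "cf_prefix (2 * k) y = cf_prefix (2 * k) x" for y
        using cylinder_diameter[OF that(1) xi that(2)] k r(2)
        by (auto simp: dist_real_def abs_minus_commute)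
      then have "x \<in> A (2 * k)" using xi by (auto simp: A_def)
      then show "x \<in> (\<Union>m. A m)" by blast
    qed
    then have "measure irr_measure B \<le> measure irr_measure (\<Union>m. A m)"
      using As by (intro irr.finite_measure_mono) auto
    ultimately show ?thesis by linarith
  qed
  then have "measure irr_measure B \<le> 0" by (rule field_le_epsilon[of _ 0, simplified])
  then show ?thesis unfolding B_def[symmetric] by (rule antisym) simp
qed

text \<open>A form of the Chung-Erdos inequality; it is the integral of
  \<open>1\<^bsub>X > 0\<^esub> \<ge> 2tX - t\<^sup>2X\<^sup>2\<close> with \<open>X\<close> the number of events that occur.\<close>
lemma (in finite_measure) second_moment_lower:
  fixes t :: real
  assumes F: "finite F" and E: "\<And>n. n \<in> F \<Longrightarrow> E n \<in> sets M" and A: "A \<in> sets M"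
  shows "2 * t * (\<Sum>n\<in>F. measure M (A \<inter> E n)) - t\<^sup>2 * (\<Sum>n\<in>F. \<Sum>m\<in>F. measure M (A \<inter> (E n \<inter> E m)))
    \<le> measure M (A \<inter> (\<Union>n\<in>F. E n))"
proof -
  let ?f = "\<lambda>x. 2 * t * (\<Sum>n\<in>F. indicator (A \<inter> E n) x) -
     t\<^sup>2 * (\<Sum>n\<in>F. \<Sum>m\<in>F. indicator (A \<inter> (E n \<inter> E m)) x) :: real"
  have I: "integrable M (indicator S :: _ \<Rightarrow> real)" if "S \<in> sets M" for S
    using that by (simp add: integrable_indicator_iff less_top[symmetric])
  have I1: "integrable M (indicator (A \<inter> E n) :: _ \<Rightarrow> real)" if "n \<in> F" for n
    using E A that by (intro I) auto
  have I2: "integrable M (indicator (A \<inter> (E n \<inter> E m)) :: _ \<Rightarrow> real)" if "n \<in> F" "m \<in> F" for n m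
    using E A that by (intro I) auto
  have US: "A \<inter> (\<Union>n\<in>F. E n) \<in> sets M" using E A F by auto
  have "(\<integral>x. ?f x \<partial>M) \<le> (\<integral>x. indicator (A \<inter> (\<Union>n\<in>F. E n)) x \<partial>M)"
  proof (rule integral_mono)
    show "integrable M ?f" using I1 I2
      by (intro Bochner_Integration.integrable_diff integrable_mult_right Bochner_Integration.integrable_sum)
    show "integrable M (indicator (A \<inter> (\<Union>n\<in>F. E n)) :: _ \<Rightarrow> real)" using US by (rule I)
    fix x
    define X where "X = (\<Sum>n\<in>F. indicator (E n) x :: real)"
    show "?f x \<le> indicator (A \<inter> (\<Union>n\<in>F. E n)) x"
    proof (cases "x \<in> A")
      case False
      then show ?thesis by simp
    next
      case True
      then have "?f x = 2 * t * X - t\<^sup>2 * (X * X)"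
        by (simp add: X_def indicator_inter_arith sum_product)
      moreover have "2 * t * X - t\<^sup>2 * (X * X) \<le> 1"
        using zero_le_power2[of "1 - t * X"] by (simp add: power2_eq_square algebra_simps)
      moreover have "X = 0" if "x \<notin> (\<Union>n\<in>F. E n)"
        using that by (auto simp: X_def intro!: sum.neutral)
      ultimately show ?thesis using True by (cases "x \<in> (\<Union>n\<in>F. E n)") auto
    qed
  qed
  moreover have "(\<integral>x. ?f x \<partial>M) = 2 * t * (\<Sum>n\<in>F. measure M (A \<inter> E n)) -
      t\<^sup>2 * (\<Sum>n\<in>F. \<Sum>m\<in>F. measure M (A \<inter> (E n \<inter> E m)))"
  proof -
    have m: "measure M (S \<inter> space M) = measure M S" if "S \<in> sets M" for S
      using sets.sets_into_space[OF that] by (simp add: Int_absorb2)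
    have m1: "measure M (A \<inter> E n \<inter> space M) = measure M (A \<inter> E n)" if "n \<in> F" for n
      using E A that by (intro m) auto
    have m2: "measure M (A \<inter> (E n \<inter> E k) \<inter> space M) = measure M (A \<inter> (E n \<inter> E k))"
      if "n \<in> F" "k \<in> F" for n k
      using E A that by (intro m) auto
    show ?thesis using I1 I2 m1 m2
      by (subst Bochner_Integration.integral_diff)
        (auto simp: Bochner_Integration.integral_sum Bochner_Integration.integrable_sum
          intro!: integrable_mult_right)
  qed
  moreover have "(\<integral>x. indicator (A \<inter> (\<Union>n\<in>F. E n)) x \<partial>M) = measure M (A \<inter> (\<Union>n\<in>F. E n))"
    using sets.sets_into_space[OF US] by (simp add: Int_absorb2)
  ultimately show ?thesis by simp
qed

section \<open>The zero-one law\<close>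

definition product_event :: "nat \<Rightarrow> real \<Rightarrow> nat \<Rightarrow> real set" where
  "product_event d t n = {x \<in> irr_unit. t \<le> real (\<Prod>i=1..d. cf_a (i * n) x)}"

text \<open>The peeling lemmas work with index sets. For n \<ge> 1 distinct \<open>i\<close> give
  distinct indices, so passing to a set loses no factor.\<close>

definition multiples :: "nat \<Rightarrow> nat \<Rightarrow> nat set" where
  "multiples d n = (\<lambda>i. i * n) ` {1..d}"

text \<open>\<open>enn2real\<close> would send infinity to 0, but for d \<ge> 1 the tail is finite
  by \<open>prod_tail_eq_tail_weight\<close>.\<close>

definition tail_weight :: "nat \<Rightarrow> real \<Rightarrow> real" where
  "tail_weight d t = enn2real (prod_tail d t)"

lemma multiples_props:
  assumes "n \<ge> 1"
  shows "finite (multiples d n)" "card (multiples d n) = d" "j \<in> multiples d n \<Longrightarrow> n \<le> j"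
    "(\<Prod>i=1..d. cf_a (i * n) x) = (\<Prod>j\<in>multiples d n. cf_a j x)"
proof -
  have inj: "inj_on (\<lambda>i. i * n) {1..d}" using assms by (auto simp: inj_on_def)
  show "finite (multiples d n)" "card (multiples d n) = d"
    using inj by (auto simp: multiples_def card_image)
  show "(\<Prod>i=1..d. cf_a (i * n) x) = (\<Prod>j\<in>multiples d n. cf_a j x)"
    unfolding multiples_def by (subst prod.reindex[OF inj]) simp
qed (auto simp: multiples_def)

lemma product_event_eq:
  "n \<ge> 1 \<Longrightarrow> product_event d t n = {x \<in> irr_unit. t \<le> real (\<Prod>j\<in>multiples d n. cf_a j x)}"
  by (simp only: product_event_def multiples_props(4))

text \<open>A common index i n = j m determines \<open>m\<close> from the pair (i, j), and there are
  d^2 pairs.\<close>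

lemma card_overlapping_multiples:
  assumes "finite F"
  shows "card {m \<in> F. 1 \<le> m \<and> multiples d n \<inter> multiples d m \<noteq> {}} \<le> d\<^sup>2"
proof -
  have "{m \<in> F. 1 \<le> m \<and> multiples d n \<inter> multiples d m \<noteq> {}} \<subseteq>
      (\<lambda>(i, j). i * n div j) ` ({1..d} \<times> {1..d})"
  proof
    fix m assume "m \<in> {m \<in> F. 1 \<le> m \<and> multiples d n \<inter> multiples d m \<noteq> {}}"
    then obtain z where "z \<in> multiples d n" "z \<in> multiples d m" by blast
    then obtain i j where ij: "i \<in> {1..d}" "j \<in> {1..d}" "i * n = j * m"
      unfolding multiples_def by blast
    have "m = i * n div j" unfolding ij(3) using ij(2) by simp
    then have "m = (\<lambda>(i, j). i * n div j) (i, j)" by simp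
    moreover have "(i, j) \<in> {1..d} \<times> {1..d}" using ij(1,2) by blast
    ultimately show "m \<in> (\<lambda>(i, j). i * n div j) ` ({1..d} \<times> {1..d})" by (rule image_eqI)
  qed
  then have "card {m \<in> F. 1 \<le> m \<and> multiples d n \<inter> multiples d m \<noteq> {}} \<le>
      card ((\<lambda>(i, j). i * n div j) ` ({1..d} \<times> {1..d}))"
    by (intro card_mono) auto
  also have "\<dots> \<le> card ({1..d} \<times> {1..d})" by (intro card_image_le) auto
  also have "\<dots> = d\<^sup>2" by (simp add: power2_eq_square)
  finally show ?thesis .
qed

section \<open>Measures of product events inside a digit event\<close>

lemma product_event_sets [measurable]: "product_event d t n \<in> sets irr_measure"
proof -
  have "product_event d t n = {x \<in> space irr_measure. t \<le> real (\<Prod>i=1..d. cf_a (i * n) x)}"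
    by (simp add: product_event_def)
  also have "\<dots> \<in> sets irr_measure" unfolding of_nat_prod by measurable
  finally show ?thesis .
qed

lemma tail_weight_nonneg: "0 \<le> tail_weight d t"
  by (simp add: tail_weight_def)

lemma prod_tail_eq_tail_weight:
  assumes "d \<ge> 1" shows "prod_tail d t = ennreal (tail_weight d t)"
proof -
  obtain e where "d = Suc e" using assms by (cases d) auto
  then have "prod_tail d t < top"
    using prod_tail_upper_aux[of e t] by (auto intro: le_less_trans)
  then show ?thesis by (simp add: tail_weight_def)
qed

lemma measure_two_product_events_le:
  assumes A: "cf_event k A" and d: "d \<ge> 1" and n: "k < n" and m: "k < m"
    and disj: "multiples d n \<inter> multiples d m = {}"
  shows "measure irr_measure (A \<inter> (product_event d t n \<inter> product_event d s m)) \<le>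
    2 ^ (2 * d) * (tail_weight d t * tail_weight d s) * measure irr_measure A"
proof -
  have nm: "n \<ge> 1" "m \<ge> 1" using n m by auto
  have "A \<subseteq> irr_unit" using sets.sets_into_space[OF cf_event_sets[OF A]] by simp
  then have eq: "A \<inter> (product_event d t n \<inter> product_event d s m) =
    {x \<in> A. t \<le> real (\<Prod>j\<in>multiples d n. cf_a j x) \<and> s \<le> real (\<Prod>j\<in>multiples d m. cf_a j x)}"
    by (auto simp: product_event_eq[OF nm(1)] product_event_eq[OF nm(2)])
  have gt: "k < j" if "j \<in> multiples d n \<union> multiples d m" for j
    using that multiples_props(3)[OF nm(1), of j d] multiples_props(3)[OF nm(2), of j d] n m by auto
  have "emeasure irr_measure (A \<inter> (product_event d t n \<inter> product_event d s m)) \<le>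
      2 ^ (d + d) * (prod_tail d t * prod_tail d s) * emeasure irr_measure A"
    using two_products_upper[where t=t and s=s, OF multiples_props(1)[OF nm(1)] multiples_props(1)[OF nm(2)] disj gt A]
    by (simp add: eq multiples_props(2)[OF nm(1)] multiples_props(2)[OF nm(2)])
  also have "\<dots> = ennreal (2 ^ (2 * d) * (tail_weight d t * tail_weight d s) * measure irr_measure A)"
    by (simp add: prod_tail_eq_tail_weight[OF d] irr.emeasure_eq_measure ennreal_mult
        tail_weight_nonneg mult_2 ennreal_power[symmetric])
  finally show ?thesis
    by (simp add: irr.emeasure_eq_measure tail_weight_nonneg)
qed

lemma measure_product_event_le:
  assumes A: "cf_event k A" and d: "d \<ge> 1" and n: "k < n"
  shows "measure irr_measure (A \<inter> product_event d t n) \<le> 2 ^ d * tail_weight d t * measure irr_measure A"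
proof -
  have n1: "n \<ge> 1" using n by auto
  have "A \<subseteq> irr_unit" using sets.sets_into_space[OF cf_event_sets[OF A]] by simp
  \<comment> \<open>The second product is empty with threshold 1: it always holds, and its tail
    \<open>prod_tail 0 1\<close> is 1.\<close>
  then have eq: "A \<inter> product_event d t n =
    {x \<in> A. t \<le> real (\<Prod>j\<in>multiples d n. cf_a j x) \<and> 1 \<le> real (\<Prod>j\<in>{}. cf_a j x)}"
    by (auto simp: product_event_eq[OF n1])
  have gt: "k < j" if "j \<in> multiples d n \<union> {}" for j
    using that multiples_props(3)[OF n1, of j d] n by auto
  have "emeasure irr_measure (A \<inter> product_event d t n) \<le> 2 ^ d * prod_tail d t * emeasure irr_measure A"
    using two_products_upper[where t=t and s=1, OF multiples_props(1)[OF n1] finite.emptyI _ gt A]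
    by (simp add: eq multiples_props(2)[OF n1])
  also have "\<dots> = ennreal (2 ^ d * tail_weight d t * measure irr_measure A)"
    by (simp add: prod_tail_eq_tail_weight[OF d] irr.emeasure_eq_measure ennreal_mult
        tail_weight_nonneg ennreal_power[symmetric])
  finally show ?thesis
    by (simp add: irr.emeasure_eq_measure tail_weight_nonneg)
qed

lemma measure_product_event_ge:
  assumes A: "cf_event k A" and d: "d \<ge> 1" and n: "k < n"
  shows "(1/4) ^ d * tail_weight d t * measure irr_measure A \<le> measure irr_measure (A \<inter> product_event d t n)"
proof -
  have n1: "n \<ge> 1" using n by auto
  have "A \<subseteq> irr_unit" using sets.sets_into_space[OF cf_event_sets[OF A]] by simp
  then have eq: "A \<inter> product_event d t n = {x \<in> A. t \<le> real (\<Prod>j\<in>multiples d n. cf_a j x)}"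
    by (auto simp: product_event_eq[OF n1])
  have gt: "k < j" if "j \<in> multiples d n" for j
    using that multiples_props(3)[OF n1, of j d] n by auto
  have "ennreal ((1/4) ^ d * tail_weight d t * measure irr_measure A) =
      ennreal (1/4) ^ d * prod_tail d t * emeasure irr_measure A"
    by (simp add: prod_tail_eq_tail_weight[OF d] irr.emeasure_eq_measure ennreal_mult
        tail_weight_nonneg ennreal_power)
  also have "\<dots> \<le> emeasure irr_measure (A \<inter> product_event d t n)"
    using product_lower[where t=t, OF multiples_props(1)[OF n1] gt A] by (simp add: eq multiples_props(2)[OF n1])
  finally show ?thesis by (simp add: irr.emeasure_eq_measure)
qed

lemma summable_tail_weight_iff:
  fixes Phi :: "nat \<Rightarrow> real"
  assumes d: "d \<ge> 1" and Phi: "\<And>n. n \<ge> 1 \<Longrightarrow> Phi n \<ge> 2"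
  shows "summable (\<lambda>n. tail_weight d (Phi (n + 1))) \<longleftrightarrow>
    summable (\<lambda>n. ln (Phi (n + 1)) ^ (d - 1) / Phi (n + 1))"
proof -
  obtain e where e: "d = Suc e" using d by (cases d) auto
  define h where "h n = ln (Phi (n + 1)) ^ e / Phi (n + 1)" for n
  obtain C where C: "C > 0" "\<And>t. t \<ge> 2 \<Longrightarrow> prod_tail (Suc e) t \<le> ennreal (C * (ln t ^ e / t))"
    using prod_tail_upper by blast
  obtain c where c: "c > 0" "\<And>t. t \<ge> 1 \<Longrightarrow> ennreal (c * (ln t ^ e / t)) \<le> prod_tail (Suc e) t"
    using prod_tail_lower by blast
  have P: "Phi (n + 1) \<ge> 2" "Phi (n + 1) \<ge> 1" for n using Phi[of "n + 1"] by auto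
  have h0: "0 \<le> h n" for n using P[of n] by (simp add: h_def)
  have up: "tail_weight d (Phi (n + 1)) \<le> C * h n" for n
  proof -
    have "ennreal (tail_weight d (Phi (n + 1))) \<le> ennreal (C * h n)"
      using C(2)[OF P(1)[of n]] unfolding e[symmetric] prod_tail_eq_tail_weight[OF d] h_def .
    moreover have "0 \<le> C * h n" using C(1) h0[of n] by simp
    ultimately show ?thesis by (simp add: ennreal_le_iff)
  qed
  have lo: "c * h n \<le> tail_weight d (Phi (n + 1))" for n
    using c(2)[OF P(2)[of n]] tail_weight_nonneg[of d "Phi (n + 1)"]
    unfolding e[symmetric] prod_tail_eq_tail_weight[OF d] h_def by simp
  have "summable (\<lambda>n. tail_weight d (Phi (n + 1))) \<longleftrightarrow> summable h"
  proof
    assume "summable (\<lambda>n. tail_weight d (Phi (n + 1)))"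
    then have "summable (\<lambda>n. c * h n)"
      by (rule summable_comparison_test'[where N=0]) (use lo h0 c in auto)
    then show "summable h" using c by (simp add: summable_cmult_iff)
  next
    assume "summable h"
    then have "summable (\<lambda>n. C * h n)" by (rule summable_mult)
    then show "summable (\<lambda>n. tail_weight d (Phi (n + 1)))"
      by (rule summable_comparison_test'[where N=0]) (use up tail_weight_nonneg in auto)
  qed
  then show ?thesis by (simp add: h_def[abs_def] e)
qed

text \<open>Provides, beyond any \<open>M\<close>, a finite block of mass at least 1, so that terms
  linear in the mass are dominated by quadratic ones.\<close>

lemma sum_nonsummable_ge_1:
  fixes g :: "nat \<Rightarrow> real"
  assumes "\<And>n. 0 \<le> g n" "\<not> summable g"
  obtains N where "1 \<le> sum g {M..<N}"
proof -
  have "\<exists>N. 1 \<le> sum g {M..<N}"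
  proof (rule ccontr)
    assume "\<not> ?thesis"
    then have less: "sum g {M..<N} < 1" for N by (simp add: not_le)
    have "summable (\<lambda>n. g (n + M))"
    proof (rule summableI_nonneg_bounded)
      fix n
      have "(\<Sum>i<n. g (i + M)) = sum g {M..<M + n}"
        using sum.shift_bounds_nat_ivl[of g 0 M n] by (simp add: lessThan_atLeast0 add.commute)
      also have "\<dots> \<le> 1" using less[of "M + n"] by simp
      finally show "(\<Sum>i<n. g (i + M)) \<le> 1" .
    qed (use assms in auto)
    then show False using assms(2) by (simp add: summable_iff_shift)
  qed
  then show thesis using that by blast
qed

text \<open>For a block of mass S \<ge> 1 beyond \<open>k\<close>, the first moment inside
  \<open>A\<close> is at least 4^-d S times the measure of \<open>A\<close>, and the second moment
  is at most D S^2 times it, where D = 2^(2d) + d^2 2^d. \<open>second_moment_lower\<close> then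
  gives a density depending on \<open>d\<close> alone, not on \<open>A\<close>, \<open>k\<close> or
  \<open>M\<close>.\<close>

lemma union_product_events_ge:
  fixes Phi :: "nat \<Rightarrow> real"
  assumes d: "d \<ge> 1" and ns: "\<not> summable (\<lambda>n. tail_weight d (Phi n))" and A: "cf_event k A"
  shows "(1/4) ^ (2 * d) / (2 ^ (2 * d) + d\<^sup>2 * 2 ^ d) * measure irr_measure A \<le>
    measure irr_measure (A \<inter> (\<Union>n\<in>{max 1 M..}. product_event d (Phi n) n))"
proof -
  define a where "a = measure irr_measure A"
  have a: "a \<ge> 0" by (simp add: a_def)
  define g where "g n = tail_weight d (Phi n)" for n
  have g: "g n \<ge> 0" for n by (simp add: g_def tail_weight_nonneg)
  define E where "E n = product_event d (Phi n) n" for n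
  \<comment> \<open>Starting above \<open>k\<close> puts every index of every event in the block
    strictly after the digits that determine \<open>A\<close>.\<close>
  define K where "K = max (max 1 M) (Suc k)"
  obtain N where N: "1 \<le> sum g {K..<N}"
    using sum_nonsummable_ge_1[of g K] g ns by (auto simp: g_def[abs_def])
  define F where "F = {K..<N}"
  define S where "S = sum g F"
  have S: "1 \<le> S" using N by (simp add: S_def F_def)
  have F: "finite F" "\<And>n. n \<in> F \<Longrightarrow> k < n" "\<And>n. n \<in> F \<Longrightarrow> 1 \<le> n" "F \<subseteq> {max 1 M..}"
    by (auto simp: F_def K_def)
  define D :: real where "D = 2 ^ (2 * d) + d\<^sup>2 * 2 ^ d"
  have D: "D > 0" by (auto simp: D_def intro!: add_pos_nonneg)
  define q :: real where "q = (1/4) ^ d"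
  have q: "q > 0" by (simp add: q_def)
  have As: "A \<in> sets irr_measure" by (rule cf_event_sets[OF A])
  have Es: "E n \<in> sets irr_measure" for n by (simp add: E_def product_event_sets)
  have first: "q * S * a \<le> (\<Sum>n\<in>F. measure irr_measure (A \<inter> E n))"
  proof -
    have "q * S * a = (\<Sum>n\<in>F. q * g n * a)" by (simp add: S_def sum_distrib_left sum_distrib_right)
    also have "\<dots> \<le> (\<Sum>n\<in>F. measure irr_measure (A \<inter> E n))"
      unfolding q_def g_def a_def E_def
      using F by (intro sum_mono measure_product_event_ge[OF A d]) auto
    finally show ?thesis .
  qed
  have row: "(\<Sum>m\<in>F. measure irr_measure (A \<inter> (E n \<inter> E m))) \<le>
      2 ^ (2 * d) * g n * S * a + d\<^sup>2 * 2 ^ d * g n * a" if n: "n \<in> F" for n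
  proof -
    \<comment> \<open>The indices whose digits overlap with those of \<open>n\<close>, among them
      \<open>n\<close> itself. Off \<open>R\<close> the product bound applies; on \<open>R\<close>
      the intersection is bounded by the event for \<open>n\<close> alone.\<close>
    define R where "R = {m \<in> F. 1 \<le> m \<and> multiples d n \<inter> multiples d m \<noteq> {}}"
    have R: "R \<subseteq> F" "real (card R) \<le> real (d\<^sup>2)"
      using card_overlapping_multiples[OF F(1), of d n] by (auto simp: R_def simp del: of_nat_power)
    have "(\<Sum>m\<in>F. measure irr_measure (A \<inter> (E n \<inter> E m))) =
       (\<Sum>m\<in>F - R. measure irr_measure (A \<inter> (E n \<inter> E m))) + (\<Sum>m\<in>R. measure irr_measure (A \<inter> (E n \<inter> E m)))"
      by (rule sum.subset_diff[OF R(1) F(1)])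
    also have "(\<Sum>m\<in>F - R. measure irr_measure (A \<inter> (E n \<inter> E m))) \<le> (\<Sum>m\<in>F - R. 2 ^ (2 * d) * (g n * g m) * a)"
      unfolding g_def a_def E_def
      using F n by (intro sum_mono measure_two_product_events_le[OF A d]) (auto simp: R_def)
    also have "\<dots> \<le> (\<Sum>m\<in>F. 2 ^ (2 * d) * (g n * g m) * a)"
      using F g a by (intro sum_mono2) auto
    also have "\<dots> = 2 ^ (2 * d) * g n * S * a"
      by (simp add: S_def sum_distrib_left sum_distrib_right mult_ac)
    also have "(\<Sum>m\<in>R. measure irr_measure (A \<inter> (E n \<inter> E m))) \<le> (\<Sum>m\<in>R. 2 ^ d * g n * a)"
    proof (rule sum_mono)
      fix m
      have "measure irr_measure (A \<inter> (E n \<inter> E m)) \<le> measure irr_measure (A \<inter> E n)"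
        using As Es by (intro irr.finite_measure_mono) auto
      also have "\<dots> \<le> 2 ^ d * g n * a"
        unfolding g_def a_def E_def using F n by (intro measure_product_event_le[OF A d]) auto
      finally show "measure irr_measure (A \<inter> (E n \<inter> E m)) \<le> 2 ^ d * g n * a" .
    qed
    also have "\<dots> \<le> real (d\<^sup>2) * (2 ^ d * g n * a)"
      using R g a by (simp del: of_nat_power add: mult_right_mono)
    finally show ?thesis by (simp add: mult_ac)
  qed
  have second: "(\<Sum>n\<in>F. \<Sum>m\<in>F. measure irr_measure (A \<inter> (E n \<inter> E m))) \<le> D * S\<^sup>2 * a"
  proof -
    have "(\<Sum>n\<in>F. \<Sum>m\<in>F. measure irr_measure (A \<inter> (E n \<inter> E m))) \<le>
        (\<Sum>n\<in>F. 2 ^ (2 * d) * g n * S * a + d\<^sup>2 * 2 ^ d * g n * a)"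
      by (intro sum_mono row)
    also have "\<dots> = 2 ^ (2 * d) * (S * S) * a + d\<^sup>2 * 2 ^ d * (S * 1) * a"
      by (simp add: sum.distrib sum_distrib_left sum_distrib_right S_def mult_ac)
    \<comment> \<open>Here S \<ge> 1 turns the linear contribution of overlapping pairs into a
      quadratic one.\<close>
    also have "\<dots> \<le> 2 ^ (2 * d) * (S * S) * a + d\<^sup>2 * 2 ^ d * (S * S) * a"
      using S a by (intro add_left_mono mult_right_mono mult_left_mono) auto
    also have "\<dots> = D * S\<^sup>2 * a" by (simp add: D_def power2_eq_square algebra_simps)
    finally show ?thesis .
  qed
  \<comment> \<open>The maximiser of 2 t q S - t^2 D S^2, with maximum q^2 / D.\<close>
  define t where "t = q / (D * S)"
  have t: "t \<ge> 0" using q D S by (simp add: t_def)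
  have "q\<^sup>2 / D * a = 2 * t * (q * S * a) - t\<^sup>2 * (D * S\<^sup>2 * a)"
    using D S by (simp add: t_def field_simps power2_eq_square)
  also have "\<dots> \<le> 2 * t * (\<Sum>n\<in>F. measure irr_measure (A \<inter> E n)) -
      t\<^sup>2 * (\<Sum>n\<in>F. \<Sum>m\<in>F. measure irr_measure (A \<inter> (E n \<inter> E m)))"
    using first second t by (intro diff_mono mult_left_mono) auto
  also have "\<dots> \<le> measure irr_measure (A \<inter> (\<Union>n\<in>F. E n))"
    by (intro irr.second_moment_lower F As Es)
  also have "\<dots> \<le> measure irr_measure (A \<inter> (\<Union>n\<in>{max 1 M..}. E n))"
    using F As Es by (intro irr.finite_measure_mono) auto
  finally show ?thesis
    by (simp add: q_def D_def a_def E_def power_mult[symmetric] mult.commute)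
qed

text \<open>The limsup form. The lower limit \<open>max 1 M\<close> excludes n = 0, where
  \<open>Phi\<close> is unconstrained.\<close>

lemma Lambda_eq_Inter:
  "Lambda d Phi = (\<Inter>M. \<Union>n\<in>{max 1 M..}. product_event d (Phi n) n)"
proof -
  have "infinite {n. 1 \<le> n \<and> P n} \<longleftrightarrow> (\<forall>M. \<exists>n\<in>{max 1 M..}. P n)" for P :: "nat \<Rightarrow> bool"
  proof -
    have "(\<forall>M. \<exists>n\<ge>M. 1 \<le> n \<and> P n) \<longleftrightarrow> (\<forall>M. \<exists>n\<in>{max 1 M..}. P n)"
      unfolding Bex_def atLeast_iff max.bounded_iff by blast
    then show ?thesis unfolding infinite_nat_iff_unbounded_le by simp
  qed
  then show ?thesis
    by (fastforce simp: Lambda_def product_event_def irr_unit_def simp del: of_nat_prod)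
qed

section \<open>The measure of \<open>Lambda\<close> in the two cases\<close>

lemma Lambda_sets: "Lambda d Phi \<in> sets irr_measure"
  unfolding Lambda_eq_Inter by (intro sets.countable_INT' sets.countable_UN') (auto intro!: sets.countable_UN')

lemma measure_irr_unit: "measure irr_measure irr_unit = 1"
proof -
  have "irr_unit \<inter> {0<..<1} = irr_unit" using irr_unit_bounds by auto
  then show ?thesis using emeasure_irr_interval[of 0 1] by (simp add: measure_def)
qed

lemma measure_Lambda_convergent:
  assumes d: "d \<ge> 1" and sm: "summable (\<lambda>n. tail_weight d (Phi (n + 1)))"
  shows "measure irr_measure (Lambda d Phi) = 0"
proof -
  let ?E = "\<lambda>n. product_event d (Phi (n + 1)) (n + 1)"
  \<comment> \<open>With no digits prescribed, the condition \<open>k < n\<close> admits every n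
    \<ge> 1.\<close>
  have ev: "cf_event 0 irr_unit" unfolding cf_event_def by (intro exI[of _ UNIV]) auto
  have le: "measure irr_measure (?E n) \<le> 2 ^ d * tail_weight d (Phi (n + 1))" for n
  proof -
    have "irr_unit \<inter> ?E n = ?E n" by (auto simp: product_event_def)
    then show ?thesis
      using measure_product_event_le[OF ev d, of "n + 1" "Phi (n + 1)"] by (simp add: measure_irr_unit)
  qed
  have "summable (\<lambda>n. measure irr_measure (?E n))"
    by (rule summable_comparison_test'[OF summable_mult[OF sm, of "2 ^ d"], where N=0]) (use le in auto)
  then have "limsup ?E \<in> null_sets irr_measure"
    by (intro borel_cantelli_limsup1) (auto simp: irr.emeasure_eq_measure)
  moreover have "Lambda d Phi \<subseteq> limsup ?E"
  proof
    fix x assume x: "x \<in> Lambda d Phi"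
    show "x \<in> limsup ?E"
      unfolding limsup_INF_SUP
    proof (intro INT_I)
      fix M :: nat
      \<comment> \<open>The event for \<open>n\<close> is \<open>?E (n - 1)\<close>, hence the shift
        to \<open>Suc M\<close>.\<close>
      from x have "x \<in> (\<Union>n\<in>{max 1 (Suc M)..}. product_event d (Phi n) n)"
        unfolding Lambda_eq_Inter by blast
      then obtain n where "n \<ge> Suc M" "x \<in> product_event d (Phi n) n" by auto
      then have "n - 1 \<in> {M..}" "x \<in> ?E (n - 1)" by auto
      then show "x \<in> (\<Union>n\<in>{M..}. ?E n)" by blast
    qed
  qed
  ultimately have "Lambda d Phi \<in> null_sets irr_measure"
    using Lambda_sets[of d Phi] by (metis null_sets_subset)
  then show ?thesis by (simp add: measure_eq_0_null_sets)
qed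

text \<open>Every tail union \<open>V M\<close> has full measure, because it has one and the same
  positive density in all digit events; a countable intersection of such sets still has full
  measure.\<close>

lemma measure_Lambda_divergent:
  assumes d: "d \<ge> 1" and ns: "\<not> summable (\<lambda>n. tail_weight d (Phi (n + 1)))"
  shows "measure irr_measure (Lambda d Phi) = 1"
proof -
  define V where "V M = (\<Union>n\<in>{max 1 M..}. product_event d (Phi n) n)" for M
  have V: "V M \<in> sets irr_measure" for M unfolding V_def by (intro sets.countable_UN') auto
  \<comment> \<open>The extra term at index 0 does not affect divergence.\<close>
  have ns': "\<not> summable (\<lambda>n. tail_weight d (Phi n))"
    using ns summable_iff_shift[of "\<lambda>n. tail_weight d (Phi n)" 1] by simp
  have "measure irr_measure (irr_unit - V M) = 0" for M
  proof (rule full_measure_of_uniform_density[OF V])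
    show "0 < (1/4) ^ (2 * d) / (2 ^ (2 * d) + real (d\<^sup>2) * 2 ^ d)"
      by (intro divide_pos_pos add_pos_nonneg) auto
  qed (use union_product_events_ge[OF d ns'] in \<open>auto simp: V_def\<close>)
  then have "irr_unit - V M \<in> null_sets irr_measure" for M
    using V sets.compl_sets[OF V, of M] by (auto simp: null_sets_def irr.emeasure_eq_measure)
  then have "(\<Union>M. irr_unit - V M) \<in> null_sets irr_measure" by (intro null_sets_UN)
  moreover have "(\<Union>M. irr_unit - V M) = irr_unit - Lambda d Phi"
    unfolding Lambda_eq_Inter V_def by blast
  ultimately have "measure irr_measure (irr_unit - Lambda d Phi) = 0"
    by (simp add: measure_eq_0_null_sets)
  then show ?thesis
    using irr.finite_measure_compl[OF Lambda_sets[of d Phi]] by (simp add: measure_irr_unit)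
qed

theorem theorem1p4:
  fixes d :: nat and Phi :: "nat \<Rightarrow> real"
  assumes "d \<ge> 1"
    and "\<And>n. n \<ge> 1 \<Longrightarrow> Phi n \<ge> 2"
  shows "Lambda d Phi \<in> sets lebesgue \<and>
    (summable (\<lambda>n. ln (Phi (n + 1)) ^ (d - 1) / Phi (n + 1))
       \<longrightarrow> measure lebesgue (Lambda d Phi) = 0) \<and>
    (\<not> summable (\<lambda>n. ln (Phi (n + 1)) ^ (d - 1) / Phi (n + 1))
       \<longrightarrow> measure lebesgue (Lambda d Phi) = 1)"
proof -
  have L: "Lambda d Phi \<in> sets lborel" "Lambda d Phi \<subseteq> irr_unit"
    using Lambda_sets[of d Phi] by (auto simp: in_sets_irr_measure)
  \<comment> \<open>On Borel subsets of \<open>irr_unit\<close> the completed, the Borel and the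
    restricted measure coincide.\<close>
  then have "measure lebesgue (Lambda d Phi) = measure irr_measure (Lambda d Phi)"
    using emeasure_irr_measure[OF L(2)] by (simp add: measure_def)
  moreover have "Lambda d Phi \<in> sets lebesgue" using L(1) by (rule sets_completionI_sets)
  moreover have "summable (\<lambda>n. tail_weight d (Phi (n + 1))) \<longleftrightarrow>
      summable (\<lambda>n. ln (Phi (n + 1)) ^ (d - 1) / Phi (n + 1))"
    by (rule summable_tail_weight_iff) (use assms in auto)
  ultimately show ?thesis
    using measure_Lambda_convergent[OF assms(1), of Phi] measure_Lambda_divergent[OF assms(1), of Phi]
    by metis
qed

end
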